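(* Let $(Z_t)_{t\ge0}$ be a (time-homogeneous, not necessarily reversible) continuous-time Markov process on a Polish space $\Omega$ with invariant distribution $\mu$. Suppose that the corresponding Markov semigroup $(\mathbf{P}_t)_{t\ge0}$ admits an iterated Poincaré gap $\eta_p>0$. Let $\nu$ be the initial distribution of the process, i.e. $Z_0\sim\nu$, and suppose that $\nu$ is absolutely continuous with respect to $\mu$ and that its density $\nu/\mu$ has a finite $p$-moment, i.e. $\|\nu/\mu\|_{L_{p,\mu}}<\infty$, for some $p\in[1,+\infty]$. Let $f:\Omega\to\mathbb{R}$ be a measurable function such that $\mathbb{E}_\mu[f]=0$, $|f|\le M$, and $\operatorname{Var}_\mu[f]\le\sigma^2$ for some $M,\sigma\in(0,+\infty)$, and assume that $f(Z_t)$ is weakly right-continuous in $t$. Then, for all $t>0$ and all $\delta\ge0$, $$\mathbb{P}\left\{\left|\frac1t\int_0^t f(Z_s)\,ds\right|\ge\delta\right\}\le 2\,\|\nu/\mu\|_{L_{p,\mu}}\exp\left(-\frac{t\,\eta_p\,\delta^2}{4qM\sqrt{4\sigma^2+\delta^2}}\right),$$ where $q=p/(p-1)\in[1,+\infty]$.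
   Context: $L_{2,\mu}$ is the Hilbert space of (square-integrable) real-valued functions on $\Omega$ with inner product $\langle f,g\rangle_\mu=\mathbb{E}_\mu[f\cdot g]$. The Markov semigroup is $\mathbf{P}_th(z)=\mathbb{E}[h(Z_t)\mid Z_0=z]$, and $\mu$ is invariant: $\mathbb{E}_\mu[\mathbf{P}_th]=\mathbb{E}_\mu[h]$. The infinitesimal generator is $\mathcal{L}h(z)=\lim_{t\to0^+}\frac{\mathbf{P}_th(z)-h(z)}{t}$, $z\in\Omega$. The semigroup admits an iterated Poincaré gap $\eta_p>0$ if $$\operatorname{Var}_\mu[h]\le\eta_p^{-2}\,\mathbb{E}_\mu\left[(\mathcal{L}h)^2\right]$$ for every $h\in L_{2,\mu}$ (for which $\mathcal{L}h$ is defined). "$f(Z_t)$ is weakly right-continuous in $t$" means: for every $z\in\Omega$, every $s\ge0$, and every bounded random variable $X=X(\{Z_t\}_{t\ge0})$ depending on the trajectory, $\lim_{\tau\to0^+}\mathbb{E}[f(Z_{s+\tau})X\mid Z_0=z]=\mathbb{E}[f(Z_s)X\mid Z_0=z]$. The map $(s,\omega)\mapsto f(Z_s(\omega))$ is assumed jointly measurable so that the time integrals are well defined. $\nu/\mu$ denotes the Radon–Nikodym density $d\nu/d\mu$, and $\|\cdot\|_{L_{p,\mu}}$ is the $L^p(\mu)$ norm (essential supremum if $p=+\infty$). Conventions: $q=1$ if $p=+\infty$; $q=+\infty$ if $p=1$, in which case the exponential is read as $1$. *)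

theory Defs
  imports "HOL-Probability.Probability"
begin

text \<open>
  A Markov process is given in canonical (Markov family) form: a measurable sample space \<open>W\<close>,
  a process \<open>Z\<close> on it (only the times \<open>t \<ge> 0\<close> matter), and for every starting point \<open>z\<close> a
  probability measure \<open>P z\<close> on \<open>W\<close>, so that integration against \<open>P z\<close> is the conditional
  expectation given \<open>Z 0 = z\<close>.  The law of the process started from the distribution \<open>\<nu>\<close> is the
  mixture \<open>\<nu> \<bind> P\<close>.
\<close>

text \<open>The sigma-algebra on the sample space generated by the variables \<open>Z u\<close>, \<open>u \<in> I\<close>.\<close>

definition process_algebra ::
    "'w measure \<Rightarrow> (real \<Rightarrow> 'w \<Rightarrow> 'a::polish_space) \<Rightarrow> real set \<Rightarrow> 'w measure" where
  "process_algebra W Z I =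
     vimage_algebra (space W) (\<lambda>\<omega>. \<lambda>u\<in>I. Z u \<omega>) (\<Pi>\<^sub>M u\<in>I. borel)"

locale markov_process =
  fixes W :: "'w measure"
    and P :: "'a::polish_space \<Rightarrow> 'w measure"
    and Z :: "real \<Rightarrow> 'w \<Rightarrow> 'a"
  assumes kernel: "P \<in> borel \<rightarrow>\<^sub>M prob_algebra W"
    and process_measurable: "0 \<le> t \<Longrightarrow> Z t \<in> W \<rightarrow>\<^sub>M borel"
    and start: "AE \<omega> in P z. Z 0 \<omega> = z"
    and markov: "0 \<le> s \<Longrightarrow> 0 \<le> t \<Longrightarrow> A \<in> sets borel \<Longrightarrow>
      AE \<omega> in P z.
        real_cond_exp (P z) (process_algebra W Z {0..s}) (\<lambda>\<omega>'. indicator A (Z (s + t) \<omega>')) \<omega>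
          = measure (P (Z s \<omega>)) {\<omega>' \<in> space W. Z t \<omega>' \<in> A}"

definition semigroup ::
    "('a::polish_space \<Rightarrow> 'w measure) \<Rightarrow> (real \<Rightarrow> 'w \<Rightarrow> 'a) \<Rightarrow> real \<Rightarrow> ('a \<Rightarrow> real) \<Rightarrow> 'a \<Rightarrow> real" where
  "semigroup P Z t h z = (\<integral>\<omega>. h (Z t \<omega>) \<partial>P z)"

definition invariant_distribution ::
    "('a::polish_space \<Rightarrow> 'w measure) \<Rightarrow> (real \<Rightarrow> 'w \<Rightarrow> 'a) \<Rightarrow> 'a measure \<Rightarrow> bool" where
  "invariant_distribution P Z \<mu> \<longleftrightarrow>
     prob_space \<mu> \<and> sets \<mu> = sets borel \<and>
     (\<forall>t\<ge>0. \<forall>h\<in>borel_measurable borel. bounded (range h) \<longrightarrow>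
        (\<integral>z. semigroup P Z t h z \<partial>\<mu>) = (\<integral>z. h z \<partial>\<mu>))"

text \<open>The generator is the pointwise limit.  Since the Bochner integral of a non-integrable
  function is \<open>0\<close>, being in the domain also requires the expectations
  in the difference quotients to exist.\<close>

definition generator ::
    "('a::polish_space \<Rightarrow> 'w measure) \<Rightarrow> (real \<Rightarrow> 'w \<Rightarrow> 'a) \<Rightarrow> ('a \<Rightarrow> real) \<Rightarrow> 'a \<Rightarrow> real" where
  "generator P Z h z = Lim (at_right 0) (\<lambda>t. (semigroup P Z t h z - h z) / t)"

definition generator_defined ::
    "('a::polish_space \<Rightarrow> 'w measure) \<Rightarrow> (real \<Rightarrow> 'w \<Rightarrow> 'a) \<Rightarrow> ('a \<Rightarrow> real) \<Rightarrow> bool" where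
  "generator_defined P Z h \<longleftrightarrow>
     (\<forall>z. (\<forall>\<^sub>F t in at_right 0. integrable (P z) (\<lambda>\<omega>. h (Z t \<omega>))) \<and>
          (\<exists>l. ((\<lambda>t. (semigroup P Z t h z - h z) / t) \<longlongrightarrow> l) (at_right 0)))"

definition L2 :: "'a measure \<Rightarrow> ('a \<Rightarrow> real) set" where
  "L2 \<mu> = {h \<in> borel_measurable \<mu>. integrable \<mu> (\<lambda>z. (h z)\<^sup>2)}"

text \<open>The right-hand side may be infinite, in which case the inequality holds trivially.\<close>

definition iterated_poincare_gap ::
    "('a::polish_space \<Rightarrow> 'w measure) \<Rightarrow> (real \<Rightarrow> 'w \<Rightarrow> 'a) \<Rightarrow> 'a measure \<Rightarrow> real \<Rightarrow> bool" where
  "iterated_poincare_gap P Z \<mu> \<eta> \<longleftrightarrow>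
     0 < \<eta> \<and>
     (\<forall>h \<in> L2 \<mu>. generator_defined P Z h \<longrightarrow>
        ennreal (prob_space.variance \<mu> h)
          \<le> ennreal (1 / \<eta>\<^sup>2) * (\<integral>\<^sup>+z. ennreal ((generator P Z h z)\<^sup>2) \<partial>\<mu>))"

definition weakly_right_continuous ::
    "'w measure \<Rightarrow> ('a::polish_space \<Rightarrow> 'w measure) \<Rightarrow> (real \<Rightarrow> 'w \<Rightarrow> 'a) \<Rightarrow> ('a \<Rightarrow> real) \<Rightarrow> bool" where
  "weakly_right_continuous W P Z f \<longleftrightarrow>
     (\<forall>z. \<forall>s\<ge>0. \<forall>X\<in>borel_measurable (process_algebra W Z {0..}). bounded (X ` space W) \<longrightarrow>
        ((\<lambda>\<tau>. \<integral>\<omega>. f (Z (s + \<tau>) \<omega>) * X \<omega> \<partial>P z)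
           \<longlongrightarrow> (\<integral>\<omega>. f (Z s \<omega>) * X \<omega> \<partial>P z)) (at_right 0))"

definition Lp_norm :: "ennreal \<Rightarrow> 'a measure \<Rightarrow> ('a \<Rightarrow> real) \<Rightarrow> ennreal" where
  "Lp_norm p \<mu> g =
     (if p = \<infinity> then esssup \<mu> (\<lambda>z. ennreal \<bar>g z\<bar>)
      else let I = (\<integral>\<^sup>+z. ennreal (\<bar>g z\<bar> powr enn2real p) \<partial>\<mu>)
           in if I = \<infinity> then \<infinity> else ennreal (enn2real I powr (1 / enn2real p)))"

text \<open>The Radon-Nikodym derivative takes extended values, but is almost everywhere finite
  when \<open>\<nu>\<close> is a probability measure.\<close>

definition density_of :: "'a measure \<Rightarrow> 'a measure \<Rightarrow> 'a \<Rightarrow> real" where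
  "density_of \<nu> \<mu> z = enn2real (RN_deriv \<mu> \<nu> z)"

text \<open>In \<open>ennreal\<close> the quotient is \<open>1 / 0 = \<infinity>\<close> for \<open>p = 1\<close>.\<close>

definition conjugate_exponent :: "ennreal \<Rightarrow> ennreal" where
  "conjugate_exponent p = (if p = \<infinity> then 1 else p / (p - 1))"

lemma conjugate_exponent_1: "conjugate_exponent 1 = \<infinity>"
  by (simp add: conjugate_exponent_def ennreal_divide_zero)

end

theory Submission
  imports Defs
begin

text \<open>
  Let \<open>S\<^sub>t = \<integral>\<^sub>0\<^sup>t f (Z\<^sub>s) ds\<close>, \<open>u\<^sub>t(z) = E\<^sub>z[exp (\<theta> S\<^sub>t)]\<close> and \<open>H\<^sub>t = \<integral>\<^sub>0\<^sup>t u\<^sub>r dr\<close>.  By the Markov property and the weak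
  right-continuity, \<open>H\<^sub>t\<close> lies in the domain of the generator at every point, and
  \<open>L H\<^sub>t = u\<^sub>t - 1 - \<theta> f H\<^sub>t\<close>.  Moreover \<open>\<bar>u\<^sub>t - 1\<bar> \<le> \<bar>\<theta>\<bar> M H\<^sub>t\<close>, because \<open>t \<mapsto> \<theta> S\<^sub>t\<close> is Lipschitz with constant
  \<open>\<bar>\<theta>\<bar> M\<close>.  Hence \<open>\<bar>L H\<^sub>t\<bar> \<le> 2 \<bar>\<theta>\<bar> M H\<^sub>t\<close>, and the iterated Poincare inequality bounds the standard deviation of
  \<open>H\<^sub>t\<close> under \<open>\<mu>\<close> by \<open>K E\<^sub>\<mu>[H\<^sub>t]\<close> with \<open>K = \<beta> / sqrt (1 - \<beta>\<^sup>2)\<close>, \<open>\<beta> = 2 \<bar>\<theta>\<bar> M / \<eta>\<close>.  Since \<open>E\<^sub>\<mu>[L H\<^sub>t] = 0\<close> and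
  \<open>E\<^sub>\<mu>[f] = 0\<close>, the moment generating function \<open>a(t) = E\<^sub>\<mu>[u\<^sub>t]\<close> satisfies
  \<open>a(t) = 1 + \<theta> E\<^sub>\<mu>[f H\<^sub>t] \<le> 1 + \<bar>\<theta>\<bar> \<sigma> K \<integral>\<^sub>0\<^sup>t a(r) dr\<close>, and Gronwall's inequality gives \<open>a(t) \<le> exp (\<bar>\<theta>\<bar> \<sigma> K t)\<close>.
  Chernoff's bound with \<open>\<theta> = \<plusminus> \<delta> \<eta> / (2 M sqrt (4 \<sigma>\<^sup>2 + \<delta>\<^sup>2))\<close>, for which \<open>K = \<delta> / (2 \<sigma>)\<close>, settles the stationary
  case, and Hoelder's inequality passes from \<open>\<mu>\<close> to \<open>\<nu>\<close>.
\<close>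

subsection \<open>Integration against kernels\<close>

lemma borel_measurable_set_lebesgue_integral:
  fixes F :: "real \<Rightarrow> 'w \<Rightarrow> real"
  assumes "sigma_finite_measure N" "(\<lambda>(v, \<omega>). F v \<omega>) \<in> borel_measurable (borel \<Otimes>\<^sub>M N)"
  shows "(\<lambda>\<omega>. LINT v:{a..b}|lborel. F v \<omega>) \<in> borel_measurable N"
proof -
  have [measurable]: "(\<lambda>(\<omega>, v). F v \<omega>) \<in> borel_measurable (N \<Otimes>\<^sub>M lborel)"
    using measurable_compose[OF measurable_pair_swap' assms(2)] by (simp add: split_beta' cong: measurable_cong_sets)
  show ?thesis
    unfolding set_lebesgue_integral_def
    by (rule lborel.borel_measurable_lebesgue_integral) measurable
qed

text \<open>Cut off outside the rectangle \<open>{a..b} \<times> space N\<close>, which has finite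
  measure, the integrand is bounded and hence integrable, so Fubini applies. Values at times outside
  \<open>{a..b}\<close> never enter.\<close>

lemma set_integral_fubini_bounded:
  fixes F :: "real \<Rightarrow> 'w \<Rightarrow> real"
  assumes "prob_space N" and F: "(\<lambda>(v, \<omega>). F v \<omega>) \<in> borel_measurable (borel \<Otimes>\<^sub>M N)"
    and C: "\<And>v \<omega>. v \<in> {a..b} \<Longrightarrow> \<omega> \<in> space N \<Longrightarrow> \<bar>F v \<omega>\<bar> \<le> C"
  shows "(\<integral>\<omega>. (LINT v:{a..b}|lborel. F v \<omega>) \<partial>N) = (LINT v:{a..b}|lborel. \<integral>\<omega>. F v \<omega> \<partial>N)"
proof -
  interpret N: prob_space N by fact
  interpret p: pair_sigma_finite lborel N ..
  have F'[measurable]: "(\<lambda>(v, \<omega>). F v \<omega>) \<in> borel_measurable (lborel \<Otimes>\<^sub>M N)"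
    using F by (simp cong: measurable_cong_sets)
  have "integrable (lborel \<Otimes>\<^sub>M N) (\<lambda>x. indicator ({a..b} \<times> space N) x *\<^sub>R (case x of (v, \<omega>) \<Rightarrow> F v \<omega>))"
    using C by (intro integrableI_bounded_set_indicator[where B=C] AE_I2)
       (auto simp: N.emeasure_pair_measure_Times N.emeasure_space_1 emeasure_lborel_Icc_eq space_pair_measure)
  also have "?this \<longleftrightarrow> integrable (lborel \<Otimes>\<^sub>M N) (\<lambda>(v, \<omega>). indicator {a..b} v *\<^sub>R F v \<omega>)"
    by (intro Bochner_Integration.integrable_cong) (auto simp: space_pair_measure indicator_def)
  finally have "(\<integral>\<omega>. (\<integral>v. indicator {a..b} v *\<^sub>R F v \<omega> \<partial>lborel) \<partial>N)
      = (\<integral>v. (\<integral>\<omega>. indicator {a..b} v *\<^sub>R F v \<omega> \<partial>N) \<partial>lborel)"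
    by (rule p.Fubini_integral)
  then show ?thesis
    by (simp add: set_lebesgue_integral_def)
qed

text \<open>If \<open>\<Phi>\<close> is not integrable, its Bochner integral is the default value 0,
  and \<open>0 \<le> C\<close> holds because a probability space is nonempty.\<close>

lemma abs_integral_le_prob:
  fixes \<Phi> :: "'w \<Rightarrow> real"
  assumes "prob_space N" "\<And>\<omega>. \<omega> \<in> space N \<Longrightarrow> \<bar>\<Phi> \<omega>\<bar> \<le> C"
  shows "\<bar>\<integral>\<omega>. \<Phi> \<omega> \<partial>N\<bar> \<le> C"
proof (cases "integrable N \<Phi>")
  interpret N: prob_space N by fact
  case True
  have "\<bar>\<integral>\<omega>. \<Phi> \<omega> \<partial>N\<bar> \<le> (\<integral>\<omega>. \<bar>\<Phi> \<omega>\<bar> \<partial>N)" by simp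
  also have "\<dots> \<le> (\<integral>\<omega>. C \<partial>N)"
    using True assms(2) by (intro integral_mono) auto
  finally show ?thesis by (simp add: N.prob_space)
next
  interpret N: prob_space N by fact
  case False
  obtain \<omega> where "\<omega> \<in> space N" using N.not_empty by auto
  from assms(2)[OF this] show ?thesis using False by (simp add: not_integrable_integral_eq)
qed

text \<open>The rule for \<open>nn_integral\<close> over a bind is applied to the nonnegative
  function \<open>C + \<Phi>\<close>. All measures have mass one, so the constant \<open>C\<close>
  comes out on both sides and cancels.\<close>

lemma integral_bind_bounded:
  fixes \<Phi> :: "'w \<Rightarrow> real"
  assumes N: "prob_space N" and K: "K \<in> N \<rightarrow>\<^sub>M prob_algebra W"
    and \<Phi>[measurable]: "\<Phi> \<in> borel_measurable W" and C: "\<And>\<omega>. \<omega> \<in> space W \<Longrightarrow> \<bar>\<Phi> \<omega>\<bar> \<le> C"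
  shows "(\<integral>\<omega>. \<Phi> \<omega> \<partial>(N \<bind> K)) = (\<integral>x. (\<integral>\<omega>. \<Phi> \<omega> \<partial>K x) \<partial>N)"
proof -
  interpret N: prob_space N by fact
  have N': "N \<in> space (prob_algebra N)" by (simp add: space_prob_algebra N)
  have K': "K \<in> N \<rightarrow>\<^sub>M subprob_algebra W" using K by (rule measurable_prob_algebraD)
  have [simp]: "sets (N \<bind> K) = sets W" by (rule sets_bind'[OF N' K])
  have [simp]: "space (N \<bind> K) = space W" by (rule sets_eq_imp_space_eq) simp
  interpret B: prob_space "N \<bind> K" by (rule prob_space_bind'[OF N' K])
  have Kx: "prob_space (K x)" "sets (K x) = sets W" if "x \<in> space N" for x
    using measurable_space[OF K that] by (auto simp: space_prob_algebra)
  have spx: "space (K x) = space W" if "x \<in> space N" for x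
    using Kx[OF that] by (intro sets_eq_imp_space_eq)
  have int: "integrable (K x) \<Phi>" if "x \<in> space N" for x
  proof -
    interpret Kx: prob_space "K x" using Kx that by auto
    show ?thesis using C Kx[OF that] spx[OF that]
      by (intro Kx.integrable_const_bound[where B=C] AE_I2) (auto cong: measurable_cong_sets)
  qed
  have mK: "(\<lambda>x. \<integral>\<omega>. \<Phi> \<omega> \<partial>K x) \<in> borel_measurable N"
    by (rule measurable_compose[OF K' integral_measurable_subprob_algebra]) fact
  have bK: "\<bar>\<integral>\<omega>. \<Phi> \<omega> \<partial>K x\<bar> \<le> C" if "x \<in> space N" for x
    using C spx[OF that] by (intro abs_integral_le_prob Kx that) auto
  have intB: "integrable (N \<bind> K) \<Phi>"
    using C by (intro B.integrable_const_bound[where B=C] AE_I2) (auto cong: measurable_cong_sets)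
  have intN: "integrable N (\<lambda>x. \<integral>\<omega>. \<Phi> \<omega> \<partial>K x)"
    using bK mK by (intro N.integrable_const_bound[where B=C] AE_I2) auto
  have "ennreal (\<integral>\<omega>. C + \<Phi> \<omega> \<partial>(N \<bind> K)) = (\<integral>\<^sup>+\<omega>. ennreal (C + \<Phi> \<omega>) \<partial>(N \<bind> K))"
    using C intB by (intro nn_integral_eq_integral[symmetric] AE_I2) (force simp: abs_le_iff)+
  also have "\<dots> = (\<integral>\<^sup>+x. \<integral>\<^sup>+\<omega>. ennreal (C + \<Phi> \<omega>) \<partial>K x \<partial>N)"
    by (rule nn_integral_bind[OF _ K']) measurable
  also have "\<dots> = (\<integral>\<^sup>+x. ennreal (C + (\<integral>\<omega>. \<Phi> \<omega> \<partial>K x)) \<partial>N)"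
  proof (rule nn_integral_cong)
    fix x assume x: "x \<in> space N"
    interpret Kx: prob_space "K x" using Kx x by auto
    have "(\<integral>\<^sup>+\<omega>. ennreal (C + \<Phi> \<omega>) \<partial>K x) = ennreal (\<integral>\<omega>. C + \<Phi> \<omega> \<partial>K x)"
      using C int[OF x] spx[OF x] by (intro nn_integral_eq_integral AE_I2) (force simp: abs_le_iff)+
    then show "(\<integral>\<^sup>+\<omega>. ennreal (C + \<Phi> \<omega>) \<partial>K x) = ennreal (C + (\<integral>\<omega>. \<Phi> \<omega> \<partial>K x))"
      using int[OF x] by (simp add: Kx.prob_space)
  qed
  also have "\<dots> = ennreal (\<integral>x. C + (\<integral>\<omega>. \<Phi> \<omega> \<partial>K x) \<partial>N)"
    using bK intN by (intro nn_integral_eq_integral AE_I2) (force simp: abs_le_iff)+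
  finally have eq: "ennreal (C + (\<integral>\<omega>. \<Phi> \<omega> \<partial>(N \<bind> K))) = ennreal (C + (\<integral>x. (\<integral>\<omega>. \<Phi> \<omega> \<partial>K x) \<partial>N))"
    using intB intN B.prob_space by (simp add: N.prob_space)
  \<comment> \<open>Both arguments of \<open>ennreal\<close> in \<open>eq\<close> must be
    nonnegative before the equation can be read off in the reals.\<close>
  have "\<bar>\<integral>\<omega>. \<Phi> \<omega> \<partial>(N \<bind> K)\<bar> \<le> C" "\<bar>\<integral>x. (\<integral>\<omega>. \<Phi> \<omega> \<partial>K x) \<partial>N\<bar> \<le> C"
    using C bK by (auto intro: abs_integral_le_prob[OF N] abs_integral_le_prob[OF B.prob_space_axioms])
  then have "0 \<le> C + (\<integral>\<omega>. \<Phi> \<omega> \<partial>(N \<bind> K))" "0 \<le> C + (\<integral>x. (\<integral>\<omega>. \<Phi> \<omega> \<partial>K x) \<partial>N)"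
    by (auto simp: abs_le_iff)
  with eq show ?thesis by simp
qed

section \<open>Markov families: measurability, bounds and the Markov property for one future
  time\<close>

context markov_process
begin

lemma prob_space_P: "prob_space (P z)" and sets_P: "sets (P z) = sets W"
  using measurable_space[OF kernel, of z] by (auto simp: space_prob_algebra)

lemma space_P: "space (P z) = space W"
  by (rule sets_eq_imp_space_eq[OF sets_P])

lemma measurable_P_iff: "\<Phi> \<in> borel_measurable (P z) \<longleftrightarrow> \<Phi> \<in> borel_measurable W"
  by (rule arg_cong[where f="(\<in>) \<Phi>"], rule measurable_cong_sets[OF sets_P refl])

lemma integrable_P:
  fixes \<Phi> :: "'w \<Rightarrow> real"
  assumes "\<Phi> \<in> borel_measurable W" "\<And>\<omega>. \<omega> \<in> space W \<Longrightarrow> \<bar>\<Phi> \<omega>\<bar> \<le> C"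
  shows "integrable (P z) \<Phi>"
proof -
  interpret prob_space "P z" by (rule prob_space_P)
  show ?thesis using assms
    by (intro integrable_const_bound[where B=C] AE_I2) (auto simp: measurable_P_iff space_P)
qed

lemma abs_integral_P_le:
  fixes \<Phi> :: "'w \<Rightarrow> real"
  assumes "\<And>\<omega>. \<omega> \<in> space W \<Longrightarrow> \<bar>\<Phi> \<omega>\<bar> \<le> C"
  shows "\<bar>\<integral>\<omega>. \<Phi> \<omega> \<partial>P z\<bar> \<le> C"
  using assms by (intro abs_integral_le_prob prob_space_P) (auto simp: space_P)

lemma measurable_integral_P [measurable]:
  fixes \<Phi> :: "'w \<Rightarrow> real"
  assumes "\<Phi> \<in> borel_measurable W"
  shows "(\<lambda>z. \<integral>\<omega>. \<Phi> \<omega> \<partial>P z) \<in> borel_measurable borel"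
  by (rule measurable_compose[OF measurable_prob_algebraD[OF kernel] integral_measurable_subprob_algebra]) fact

lemma measurable_semigroup [measurable]:
  assumes "0 \<le> t" and [measurable]: "g \<in> borel_measurable borel"
  shows "semigroup P Z t g \<in> borel_measurable borel"
proof -
  note process_measurable[OF assms(1), measurable]
  have "(\<lambda>z. \<integral>\<omega>. g (Z t \<omega>) \<partial>P z) \<in> borel_measurable borel" by measurable
  then show ?thesis by (simp add: semigroup_def[abs_def])
qed

lemma abs_semigroup_le:
  assumes "\<And>x. \<bar>g x\<bar> \<le> C" shows "\<bar>semigroup P Z t g z\<bar> \<le> C"
  unfolding semigroup_def by (rule abs_integral_P_le) (rule assms)

lemma process_measurable_algebra: "u \<in> I \<Longrightarrow> Z u \<in> process_algebra W Z I \<rightarrow>\<^sub>M borel"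
proof -
  assume u: "u \<in> I"
  have "(\<lambda>\<omega>. \<lambda>u\<in>I. Z u \<omega>) \<in> process_algebra W Z I \<rightarrow>\<^sub>M (\<Pi>\<^sub>M u\<in>I. borel)"
    unfolding process_algebra_def by (rule measurable_vimage_algebra1) (auto simp: space_PiM)
  from measurable_compose[OF this measurable_component_singleton[OF u]] u
  show ?thesis by simp
qed

lemma subalgebra_process_algebra:
  assumes "I \<subseteq> {0..}" shows "subalgebra (P z) (process_algebra W Z I)"
proof -
  have "(\<lambda>\<omega>. \<lambda>u\<in>I. Z u \<omega>) \<in> W \<rightarrow>\<^sub>M (\<Pi>\<^sub>M u\<in>I. borel)"
    using assms by (intro measurable_restrict process_measurable) auto
  then have "sets (process_algebra W Z I) \<subseteq> sets W"
    unfolding process_algebra_def sets_vimage_algebra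
    by (intro sets.sigma_sets_subset) (auto intro: measurable_sets)
  then show ?thesis
    by (simp add: subalgebra_def sets_P space_P process_algebra_def)
qed

text \<open>The axiom \<open>markov\<close> speaks of indicators conditioned on the past. Tested
  against the past-measurable factor \<open>X\<close> it gives the claim for indicators; scaling,
  sums and monotone limits give it for nonnegative bounded functions, and adding the constant
  \<open>C\<close> reaches every bounded \<open>g\<close>.\<close>

lemma markov_integral:
  assumes s: "0 \<le> s" and r: "0 \<le> r"
    and X: "X \<in> borel_measurable (process_algebra W Z {0..s})"
    and B: "\<And>\<omega>. \<omega> \<in> space W \<Longrightarrow> \<bar>X \<omega>\<bar> \<le> B"
    and g: "g \<in> borel_measurable borel" and C: "\<And>x. \<bar>g x\<bar> \<le> C"
  shows "(\<integral>\<omega>. X \<omega> * g (Z (s + r) \<omega>) \<partial>P z) = (\<integral>\<omega>. X \<omega> * semigroup P Z r g (Z s \<omega>) \<partial>P z)"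
proof -
  interpret Pz: prob_space "P z" by (rule prob_space_P)
  interpret F: finite_measure_subalgebra "P z" "process_algebra W Z {0..s}"
    by unfold_locales (rule subalgebra_process_algebra, auto)
  note [measurable] = process_measurable[OF s] process_measurable[OF r] process_measurable[OF add_nonneg_nonneg[OF s r]]
  have XW[measurable]: "X \<in> borel_measurable W"
    using measurable_from_subalg[OF F.subalg X] by (simp add: measurable_P_iff)
  have intX: "integrable (P z) (\<lambda>\<omega>. X \<omega> * h \<omega>)"
    if [measurable]: "h \<in> borel_measurable W" and "\<And>\<omega>. \<omega> \<in> space W \<Longrightarrow> \<bar>h \<omega>\<bar> \<le> b" for h b
    using B that(2) by (intro integrable_P[where C="B * b"]) (auto simp: abs_mult intro!: mult_mono' )
  have B0: "0 \<le> B"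
  proof -
    obtain \<omega> where "\<omega> \<in> space W" using Pz.not_empty space_P by auto
    from B[OF this] show ?thesis by linarith
  qed
  \<comment> \<open>Boundedness is kept inside the induction statement, because the summands and
    approximants must again have integrals that exist.\<close>
  have nonneg: "(\<integral>\<omega>. X \<omega> * g (Z (s + r) \<omega>) \<partial>P z) = (\<integral>\<omega>. X \<omega> * semigroup P Z r g (Z s \<omega>) \<partial>P z)"
    if "g \<in> borel_measurable borel" "\<And>x. 0 \<le> g x" "\<exists>C. \<forall>x. g x \<le> C" for g
    using that
  proof (induction g rule: borel_measurable_induct_real)
    case (set A)
    have [measurable]: "A \<in> sets borel" by fact
    have "(\<integral>\<omega>. X \<omega> * indicator A (Z (s + r) \<omega>) \<partial>P z)
        = (\<integral>\<omega>. X \<omega> * real_cond_exp (P z) (process_algebra W Z {0..s}) (\<lambda>\<omega>'. indicator A (Z (s + r) \<omega>')) \<omega> \<partial>P z)"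
    proof (rule F.real_cond_exp_intg(2)[symmetric])
      show "integrable (P z) (\<lambda>\<omega>. X \<omega> * indicator A (Z (s + r) \<omega>))"
        by (rule intX[of _ 1]) (auto simp: indicator_def)
    qed (simp_all add: X measurable_P_iff)
    also have "\<dots> = (\<integral>\<omega>. X \<omega> * semigroup P Z r (indicator A) (Z s \<omega>) \<partial>P z)"
    proof (rule integral_cong_AE)
      have [measurable]: "semigroup P Z r (indicator A) \<in> borel_measurable borel"
        by (rule measurable_semigroup[OF r]) measurable
      show "(\<lambda>\<omega>. X \<omega> * semigroup P Z r (indicator A) (Z s \<omega>)) \<in> borel_measurable (P z)"
        unfolding measurable_P_iff by measurable
      have "measure (P y) {\<omega>' \<in> space W. Z r \<omega>' \<in> A} = semigroup P Z r (indicator A) y" for y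
      proof -
        interpret Py: prob_space "P y" by (rule prob_space_P)
        have "semigroup P Z r (indicator A) y = (\<integral>\<omega>. indicator {\<omega>' \<in> space W. Z r \<omega>' \<in> A} \<omega> \<partial>P y)"
          unfolding semigroup_def
          by (intro Bochner_Integration.integral_cong) (auto simp: indicator_def space_P)
        then show ?thesis by (simp add: space_P Int_def conj_commute)
      qed
      with markov[OF s r \<open>A \<in> sets borel\<close>, of z]
      show "AE \<omega> in P z. X \<omega> * real_cond_exp (P z) (process_algebra W Z {0..s}) (\<lambda>\<omega>'. indicator A (Z (s + r) \<omega>')) \<omega>
          = X \<omega> * semigroup P Z r (indicator A) (Z s \<omega>)"
        by auto
      have [measurable]: "real_cond_exp (P z) (process_algebra W Z {0..s}) (\<lambda>\<omega>'. indicator A (Z (s + r) \<omega>')) \<in> borel_measurable W"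
        using borel_measurable_cond_exp2[of "P z"] by (simp add: measurable_P_iff)
      show "(\<lambda>\<omega>. X \<omega> * real_cond_exp (P z) (process_algebra W Z {0..s}) (\<lambda>\<omega>'. indicator A (Z (s + r) \<omega>')) \<omega>) \<in> borel_measurable (P z)"
        unfolding measurable_P_iff by measurable
    qed
    finally show ?case .
  next
    case (mult u c)
    show ?case
    proof (cases "c = 0")
      case False
      then have "c > 0" using mult by auto
      from mult.prems obtain C where "\<And>x. c * u x \<le> C" by auto
      then have "\<And>x. u x \<le> C / c" using \<open>c > 0\<close> by (simp add: field_simps)
      then have "\<exists>C. \<forall>x. u x \<le> C" by blast
      from mult.IH[OF this] show ?thesis
        by (simp add: semigroup_def mult.left_commute[of _ c])
    qed (simp add: semigroup_def)
  next
    case (add u v)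
    note [measurable] = add.hyps(1,3)
    from add.prems obtain C where C: "\<And>x. v x + u x \<le> C" by auto
    have uC: "u x \<le> C" "v x \<le> C" for x
      using C[of x] add.hyps(2,4)[of x] by auto
    have absC: "\<And>x. \<bar>u x\<bar> \<le> C" "\<And>x. \<bar>v x\<bar> \<le> C" using uC add.hyps(2,4) by auto
    have sg: "semigroup P Z r (\<lambda>x. v x + u x) y = semigroup P Z r v y + semigroup P Z r u y" for y
      unfolding semigroup_def using absC
      by (intro Bochner_Integration.integral_add integrable_P[where C=C]) auto
    have [measurable]: "semigroup P Z r v \<in> borel_measurable borel" "semigroup P Z r u \<in> borel_measurable borel"
      by (auto intro!: measurable_semigroup[OF r])
    have "(\<integral>\<omega>. X \<omega> * u (Z (s + r) \<omega>) \<partial>P z) = (\<integral>\<omega>. X \<omega> * semigroup P Z r u (Z s \<omega>) \<partial>P z)"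
      "(\<integral>\<omega>. X \<omega> * v (Z (s + r) \<omega>) \<partial>P z) = (\<integral>\<omega>. X \<omega> * semigroup P Z r v (Z s \<omega>) \<partial>P z)"
      using add.IH uC by blast+
    then show ?case
      using absC abs_semigroup_le[OF absC(1)] abs_semigroup_le[OF absC(2)]
      by (simp add: sg distrib_left Bochner_Integration.integral_add intX[of _ C])
  next
    case (seq U)
    note [measurable] = seq.hyps(1)
    from seq.prems obtain C where C: "\<And>x. g x \<le> C" by auto
    have lim: "(\<lambda>i. U i x) \<longlonglongrightarrow> g x" for x using seq.hyps(4) by simp
    have Ug: "U i x \<le> g x" for i x
      using incseq_le[OF _ lim, of x i] \<open>incseq U\<close> by (auto simp: incseq_def le_fun_def)
    have absU: "\<bar>U i x\<bar> \<le> C" for i x using Ug[of i x] C[of x] seq.hyps(2)[of i x] by auto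
    have [measurable]: "g \<in> borel_measurable borel"
      by (rule borel_measurable_LIMSEQ_real[where u=U]) (use lim in auto)
    have absg: "\<bar>g x\<bar> \<le> C" for x
      using LIMSEQ_le_const2[OF tendsto_rabs[OF lim[of x]], of C] absU by auto
    have [measurable]: "semigroup P Z r (U i) \<in> borel_measurable borel" "semigroup P Z r g \<in> borel_measurable borel" for i
      by (auto intro!: measurable_semigroup[OF r])
    have l1: "(\<lambda>i. \<integral>\<omega>. X \<omega> * U i (Z (s + r) \<omega>) \<partial>P z) \<longlonglongrightarrow> (\<integral>\<omega>. X \<omega> * g (Z (s + r) \<omega>) \<partial>P z)"
      using absU absg B B0 lim
      by (intro integral_dominated_convergence[where w="\<lambda>_. B * C"] AE_I2)
        (auto simp: measurable_P_iff abs_mult space_P intro!: mult_mono tendsto_intros)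
    have l2: "(\<lambda>i. semigroup P Z r (U i) y) \<longlonglongrightarrow> semigroup P Z r g y" for y
    proof -
      interpret Py: prob_space "P y" by (rule prob_space_P)
      show ?thesis
        unfolding semigroup_def using absU lim
        by (intro integral_dominated_convergence[where w="\<lambda>_. C"] AE_I2) (auto simp: measurable_P_iff)
    qed
    have l3: "(\<lambda>i. \<integral>\<omega>. X \<omega> * semigroup P Z r (U i) (Z s \<omega>) \<partial>P z) \<longlonglongrightarrow> (\<integral>\<omega>. X \<omega> * semigroup P Z r g (Z s \<omega>) \<partial>P z)"
      using abs_semigroup_le[OF absU] B B0 l2
      by (intro integral_dominated_convergence[where w="\<lambda>_. B * C"] AE_I2)
        (auto simp: measurable_P_iff abs_mult space_P intro!: mult_mono tendsto_intros)
    have "(\<integral>\<omega>. X \<omega> * U i (Z (s + r) \<omega>) \<partial>P z) = (\<integral>\<omega>. X \<omega> * semigroup P Z r (U i) (Z s \<omega>) \<partial>P z)" for i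
      using absU by (intro seq.IH exI[of _ C]) (auto simp: abs_le_iff)
    with l1 l3 show ?case by (simp add: LIMSEQ_unique)
  qed
  note [measurable] = g measurable_semigroup[OF r g]
  have sgC: "semigroup P Z r (\<lambda>x. C + g x) y = C + semigroup P Z r g y" for y
  proof -
    interpret Py: prob_space "P y" by (rule prob_space_P)
    have "integrable (P y) (\<lambda>\<omega>. g (Z r \<omega>))" using C by (intro integrable_P[where C=C]) auto
    then show ?thesis by (simp add: semigroup_def Py.prob_space)
  qed
  have int: "integrable (P z) (\<lambda>\<omega>. X \<omega> * C)" "integrable (P z) (\<lambda>\<omega>. X \<omega> * g (Z (s + r) \<omega>))"
    "integrable (P z) (\<lambda>\<omega>. X \<omega> * semigroup P Z r g (Z s \<omega>))"
    by (rule intX[of _ "\<bar>C\<bar>"] intX[of _ C]; use C abs_semigroup_le[of g C, OF C] in simp)+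
  have "(\<integral>\<omega>. X \<omega> * (C + g (Z (s + r) \<omega>)) \<partial>P z) = (\<integral>\<omega>. X \<omega> * (C + semigroup P Z r g (Z s \<omega>)) \<partial>P z)"
  proof -
    have "0 \<le> C + g x" "C + g x \<le> C + C" for x using C[of x] by auto
    then have "\<And>x. 0 \<le> C + g x" "\<exists>B. \<forall>x. C + g x \<le> B" by blast+
    then show ?thesis
      using nonneg[of "\<lambda>x. C + g x"] by (auto simp: sgC)
  qed
  then show ?thesis using int by (simp add: distrib_left)
qed

end

subsection \<open>The Markov property for cylinder functions\<close>

text \<open>The offset \<open>\<tau>\<close> moves all times at once:
  \<open>cylinder Z \<tau> L\<close> is \<open>cylinder Z 0 L\<close> evaluated on the path shifted
  by \<open>\<tau>\<close>. A list admits repeated times and lets one factor be removed at a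
  time.\<close>

definition cylinder :: "(real \<Rightarrow> 'w \<Rightarrow> 'a) \<Rightarrow> real \<Rightarrow> (real \<times> ('a \<Rightarrow> real)) list \<Rightarrow> 'w \<Rightarrow> real" where
  "cylinder Z \<tau> L \<omega> = (\<Prod>(s, g)\<leftarrow>L. g (Z (\<tau> + s) \<omega>))"

lemma cylinder_simps [simp]:
  "cylinder Z \<tau> [] \<omega> = 1"
  "cylinder Z \<tau> ((s, g) # L) \<omega> = g (Z (\<tau> + s) \<omega>) * cylinder Z \<tau> L \<omega>"
  by (simp_all add: cylinder_def)

text \<open>Multiplication is commutative, which permits sorting the factors by time.\<close>

lemma cylinder_cong_mset:
  assumes "mset L = mset L'" shows "cylinder Z \<tau> L \<omega> = cylinder Z \<tau> L' \<omega>"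
proof -
  have "mset (map (\<lambda>(s, g). g (Z (\<tau> + s) \<omega>)) L) = mset (map (\<lambda>(s, g). g (Z (\<tau> + s) \<omega>)) L')"
    using assms by simp
  then show ?thesis
    unfolding cylinder_def prod_mset_prod_list[symmetric] by simp
qed

definition cylinder_data :: "(real \<times> ('a::topological_space \<Rightarrow> real)) list \<Rightarrow> bool" where
  "cylinder_data L \<longleftrightarrow> (\<forall>(s, g) \<in> set L. 0 \<le> s \<and> g \<in> borel_measurable borel \<and> (\<exists>C. \<forall>x. \<bar>g x\<bar> \<le> C))"

lemma cylinder_data_simps [simp]:
  "cylinder_data []"
  "cylinder_data ((s, g) # L) \<longleftrightarrow>
    0 \<le> s \<and> g \<in> borel_measurable borel \<and> (\<exists>C. \<forall>x. \<bar>g x\<bar> \<le> C) \<and> cylinder_data L"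
  by (auto simp: cylinder_data_def)

lemma cylinder_bounded:
  assumes "cylinder_data L" obtains C where "\<And>\<tau> \<omega>. \<bar>cylinder Z \<tau> L \<omega>\<bar> \<le> C"
proof -
  have "\<exists>C. \<forall>\<tau> \<omega>. \<bar>cylinder Z \<tau> L \<omega>\<bar> \<le> C"
    using assms
  proof (induction L)
    case Nil then show ?case by auto
  next
    case (Cons a L)
    obtain s g where a: "a = (s, g)" by force
    from Cons a obtain C D where C: "\<And>\<tau> \<omega>. \<bar>cylinder Z \<tau> L \<omega>\<bar> \<le> C" and D: "\<And>x. \<bar>g x\<bar> \<le> D"
      by auto
    have "0 \<le> D" using D[of undefined] by linarith
    then have "\<bar>cylinder Z \<tau> (a # L) \<omega>\<bar> \<le> D * C" for \<tau> \<omega>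
      using C D by (auto simp: a abs_mult intro!: mult_mono)
    then show ?case by blast
  qed
  with that show ?thesis by blast
qed

context markov_process
begin

lemma measurable_cylinder [measurable]:
  assumes "0 \<le> \<tau>" "cylinder_data L" shows "cylinder Z \<tau> L \<in> borel_measurable W"
  using assms(2)
proof (induction L)
  case (Cons a L)
  obtain s g where a: "a = (s, g)" by force
  have [measurable]: "Z (\<tau> + s) \<in> W \<rightarrow>\<^sub>M borel" "g \<in> borel_measurable borel" "cylinder Z \<tau> L \<in> borel_measurable W"
    using Cons a assms by (auto intro: process_measurable)
  have "(\<lambda>\<omega>. g (Z (\<tau> + s) \<omega>) * cylinder Z \<tau> L \<omega>) \<in> borel_measurable W" by measurable
  then show ?case by (simp add: a)
qed (simp add: cylinder_def[abs_def])

lemma measurable_cylinder_algebra: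
  assumes "0 \<le> \<tau>" "cylinder_data L" "\<forall>(r, g)\<in>set L. r \<le> s"
  shows "cylinder Z \<tau> L \<in> borel_measurable (process_algebra W Z {0..\<tau> + s})"
  using assms(2,3)
proof (induction L)
  case (Cons a L)
  obtain r g where a: "a = (r, g)" by force
  have [measurable]: "Z (\<tau> + r) \<in> process_algebra W Z {0..\<tau> + s} \<rightarrow>\<^sub>M borel" "g \<in> borel_measurable borel"
    "cylinder Z \<tau> L \<in> borel_measurable (process_algebra W Z {0..\<tau> + s})"
    using Cons a assms(1) by (auto intro!: process_measurable_algebra)
  have "(\<lambda>\<omega>. g (Z (\<tau> + r) \<omega>) * cylinder Z \<tau> L \<omega>) \<in> borel_measurable (process_algebra W Z {0..\<tau> + s})"
    by measurable
  then show ?case by (simp add: a)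
qed (simp add: cylinder_def[abs_def])

text \<open>By the Markov property this is also the law of the path shifted by \<open>\<tau>\<close>.\<close>

definition restarted :: "'a \<Rightarrow> real \<Rightarrow> 'w measure" where
  "restarted z \<tau> = P z \<bind> (\<lambda>\<omega>. P (Z \<tau> \<omega>))"

lemma measurable_restart: "0 \<le> \<tau> \<Longrightarrow> (\<lambda>\<omega>. P (Z \<tau> \<omega>)) \<in> P z \<rightarrow>\<^sub>M prob_algebra W"
  using measurable_compose[OF process_measurable kernel] by (simp add: measurable_cong_sets[OF sets_P refl])

lemma
  assumes "0 \<le> \<tau>"
  shows prob_space_restarted: "prob_space (restarted z \<tau>)"
    and sets_restarted: "sets (restarted z \<tau>) = sets W"
  unfolding restarted_def
  by (auto intro!: prob_space_bind'[OF _ measurable_restart[OF assms]] sets_bind'[OF _ measurable_restart[OF assms]]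
    simp: space_prob_algebra prob_space_P)

lemma integral_restarted:
  assumes "0 \<le> \<tau>" "\<Phi> \<in> borel_measurable W" "\<And>\<omega>. \<omega> \<in> space W \<Longrightarrow> \<bar>\<Phi> \<omega>\<bar> \<le> (C::real)"
  shows "(\<integral>\<omega>. \<Phi> \<omega> \<partial>restarted z \<tau>) = (\<integral>\<omega>. (\<integral>\<omega>'. \<Phi> \<omega>' \<partial>P (Z \<tau> \<omega>)) \<partial>P z)"
  unfolding restarted_def
  by (rule integral_bind_bounded[OF prob_space_P measurable_restart]) (use assms in auto)

lemma integral_initial:
  assumes [measurable]: "g \<in> borel_measurable borel"
  shows "(\<integral>\<omega>. g (Z 0 \<omega>) \<partial>P y) = (g y::real)"
proof -
  interpret Py: prob_space "P y" by (rule prob_space_P)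
  have [measurable]: "Z 0 \<in> W \<rightarrow>\<^sub>M borel" by (rule process_measurable) simp
  have "(\<integral>\<omega>. g (Z 0 \<omega>) \<partial>P y) = (\<integral>\<omega>. g y \<partial>P y)"
    by (rule integral_cong_AE) (use start[of y] in \<open>auto simp: measurable_P_iff\<close>)
  then show ?thesis by (simp add: Py.prob_space)
qed

text \<open>The latest time \<open>s\<close> stands in front and all other factors are measurable
  with respect to the history up to \<open>\<tau> + s1\<close>. Conditioning on that history
  replaces \<open>g\<close> at time \<open>s\<close> by \<open>semigroup P Z (s - s1) g\<close> at
  time \<open>s1\<close>, where it merges with \<open>h\<close>.\<close>

lemma cylinder_peel:
  assumes \<tau>: "0 \<le> \<tau>" and s: "0 \<le> s1" "s1 \<le> s"
    and g: "g \<in> borel_measurable borel" "\<And>x. \<bar>g x\<bar> \<le> C"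
    and h: "h \<in> borel_measurable borel" "\<And>x. \<bar>h x\<bar> \<le> D"
    and R: "cylinder_data R" "\<forall>(r, g)\<in>set R. r \<le> s1"
  shows "(\<integral>\<omega>. cylinder Z \<tau> ((s, g) # (s1, h) # R) \<omega> \<partial>P z)
    = (\<integral>\<omega>. cylinder Z \<tau> ((s1, \<lambda>x. h x * semigroup P Z (s - s1) g x) # R) \<omega> \<partial>P z)"
proof -
  have data: "cylinder_data ((s1, h) # R)" using s h R by auto
  then obtain B where B: "\<And>\<tau> \<omega>. \<bar>cylinder Z \<tau> ((s1, h) # R) \<omega>\<bar> \<le> B" using cylinder_bounded[OF data, where Z=Z] by blast
  have "(\<integral>\<omega>. cylinder Z \<tau> ((s1, h) # R) \<omega> * g (Z ((\<tau> + s1) + (s - s1)) \<omega>) \<partial>P z)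
    = (\<integral>\<omega>. cylinder Z \<tau> ((s1, h) # R) \<omega> * semigroup P Z (s - s1) g (Z (\<tau> + s1) \<omega>) \<partial>P z)"
    by (rule markov_integral[where B=B and C=C])
       (use \<tau> s g B data R measurable_cylinder_algebra[OF \<tau> data, of s1] in \<open>auto simp del: cylinder_simps\<close>)
  then show ?thesis by (simp add: mult_ac)
qed

text \<open>Peeling the latest factor shortens the list in the same way on both sides, at offset
  \<open>\<tau>\<close> on the left and at offset 0 under \<open>P (Z \<tau> \<omega>)\<close> on
  the right. What remains is one factor at time 0, where both sides equal the expectation of
  \<open>g (Z \<tau> \<omega>)\<close>.\<close>

lemma cylinder_markov_sorted:
  assumes "0 \<le> \<tau>" "sorted_wrt (\<ge>) (map fst ((s, g) # R))" "fst (last ((s, g) # R)) = 0"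
    "cylinder_data ((s, g) # R)"
  shows "(\<integral>\<omega>. cylinder Z \<tau> ((s, g) # R) \<omega> \<partial>P z)
    = (\<integral>\<omega>. (\<integral>\<omega>'. cylinder Z 0 ((s, g) # R) \<omega>' \<partial>P (Z \<tau> \<omega>)) \<partial>P z)"
  using assms(2-)
proof (induction R arbitrary: s g)
  case Nil
  then show ?case by (simp add: integral_initial)
next
  case (Cons a R)
  obtain s1 h where a: "a = (s1, h)" by force
  from Cons.prems a obtain C D where g: "g \<in> borel_measurable borel" "\<And>x. \<bar>g x\<bar> \<le> C"
    and h: "h \<in> borel_measurable borel" "\<And>x. \<bar>h x\<bar> \<le> D" and s: "0 \<le> s1" "s1 \<le> s"
    and R: "cylinder_data R" "\<forall>(r, g)\<in>set R. r \<le> s1"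
    by (auto simp: split_beta)
  note peel = cylinder_peel[OF _ s g h R]
  have "0 \<le> D" using h(2)[of undefined] by linarith
  then have "\<bar>h x * semigroup P Z (s - s1) g x\<bar> \<le> D * C" for x
    using h abs_semigroup_le[OF g(2)] by (auto simp: abs_mult intro!: mult_mono)
  then have "\<exists>C. \<forall>x. \<bar>h x * semigroup P Z (s - s1) g x\<bar> \<le> C" by blast
  moreover have [measurable]: "semigroup P Z (s - s1) g \<in> borel_measurable borel"
    using s g by (intro measurable_semigroup) auto
  ultimately show ?case
    unfolding a using peel[OF assms(1)] peel[OF order_refl] Cons.prems h(1)
    by (subst peel[OF assms(1)], subst peel[OF order_refl], intro Cons.IH)
       (auto simp: a split: if_splits)
qed

text \<open>Reduction to the sorted case by rearranging the factors.\<close>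

lemma cylinder_markov:
  assumes \<tau>: "0 \<le> \<tau>" and L: "cylinder_data L"
  shows "(\<integral>\<omega>. cylinder Z \<tau> L \<omega> \<partial>P z) = (\<integral>\<omega>. cylinder Z 0 L \<omega> \<partial>restarted z \<tau>)"
proof -
  \<comment> \<open>The dummy factor 1 at time 0 leaves the product unchanged and ensures that the
    list is nonempty and its earliest time is exactly 0, where the recursion has to end.\<close>
  define L0 where "L0 = (0, \<lambda>_. 1) # L"
  define R where "R = rev (sort_key fst L0)"
  have mset: "mset R = mset L0" and set: "set R = set L0"
    by (auto simp: R_def)
  have data: "cylinder_data R"
    using L unfolding cylinder_data_def set by (auto simp: L0_def intro!: exI[of _ 1])
  have sorted: "sorted_wrt (\<ge>) (map fst R)"
    unfolding R_def by (simp add: rev_map[symmetric] sorted_wrt_rev)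
  have "R \<noteq> []" using mset by (auto simp: L0_def)
  then obtain s g R' where R: "R = (s, g) # R'" by (cases R) auto
  \<comment> \<open>The last entry has the smallest time: at most 0 because of the dummy factor, at
    least 0 because all times in \<open>R\<close> are nonnegative.\<close>
  have "fst (last R) = 0"
  proof -
    have last: "fst (last R) \<le> fst x" if "x \<in> set R" for x
      using sorted that \<open>R \<noteq> []\<close> by (induction R) auto
    have "(0, \<lambda>_. 1) \<in> set R" by (simp add: set L0_def)
    from last[OF this] have "fst (last R) \<le> 0" by simp
    moreover have "last R \<in> set R" using \<open>R \<noteq> []\<close> by simp
    ultimately show ?thesis using data unfolding cylinder_data_def by (fastforce simp: split_beta)
  qed
  have eq: "cylinder Z \<tau> L = cylinder Z \<tau> R" for \<tau>
  proof
    fix \<omega>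
    have "cylinder Z \<tau> R \<omega> = cylinder Z \<tau> L0 \<omega>" by (rule cylinder_cong_mset[OF mset])
    then show "cylinder Z \<tau> L \<omega> = cylinder Z \<tau> R \<omega>" by (simp add: L0_def)
  qed
  obtain C where C: "\<And>\<tau> \<omega>. \<bar>cylinder Z \<tau> R \<omega>\<bar> \<le> C" using cylinder_bounded[OF data, where Z=Z] by blast
  have "(\<integral>\<omega>. cylinder Z \<tau> R \<omega> \<partial>P z) = (\<integral>\<omega>. (\<integral>\<omega>'. cylinder Z 0 R \<omega>' \<partial>P (Z \<tau> \<omega>)) \<partial>P z)"
    unfolding R by (rule cylinder_markov_sorted[OF \<tau>]) (use sorted \<open>fst (last R) = 0\<close> data R in auto)
  also have "\<dots> = (\<integral>\<omega>. cylinder Z 0 R \<omega> \<partial>restarted z \<tau>)"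
    by (rule integral_restarted[symmetric, OF \<tau> _ C]) (rule measurable_cylinder[OF order_refl data])
  finally show ?thesis by (simp add: eq)
qed

end

subsection \<open>Exponentials of Lipschitz paths\<close>

lemma set_integrable_const_Icc: "set_integrable lborel {a..b::real} (\<lambda>_. c::real)"
  by (rule borel_integrable_atLeastAtMost') simp

lemma abs_set_integral_Icc_le:
  fixes g :: "real \<Rightarrow> real"
  assumes "a \<le> b" and B: "\<And>x. x \<in> {a..b} \<Longrightarrow> \<bar>g x\<bar> \<le> B"
  shows "\<bar>LINT x:{a..b}|lborel. g x\<bar> \<le> B * (b - a)"
proof (cases "set_integrable lborel {a..b} g")
  case True
  have "norm (LINT x:{a..b}|lborel. g x) \<le> (LINT x:{a..b}|lborel. norm (g x))"
    by (rule set_integral_norm_bound[OF True])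
  also have "\<dots> \<le> (LINT x:{a..b}|lborel. B)"
    using B by (intro set_integral_mono set_integrable_norm True set_integrable_const_Icc) auto
  also have "\<dots> = B * (b - a)"
    using assms(1) by (simp add: set_lebesgue_integral_def)
  finally show ?thesis by simp
next
  case False
  \<comment> \<open>The integral of a non-integrable function is 0 by default, so only the sign of
    \<open>B\<close> matters here.\<close>
  have "0 \<le> B" using B[of a] assms(1) by force
  with False show ?thesis
    using assms(1) by (simp add: set_integrable_def set_lebesgue_integral_def not_integrable_integral_eq)
qed

lemma set_integral_Icc_combine:
  fixes g :: "real \<Rightarrow> real"
  assumes "a \<le> b" "b \<le> c" and g: "set_integrable lborel {a..c} g"
  shows "(LINT x:{a..c}|lborel. g x) = (LINT x:{a..b}|lborel. g x) + (LINT x:{b..c}|lborel. g x)"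
proof -
  have sub: "set_integrable lborel {a..b} g" "set_integrable lborel {b..c} g"
    using assms by (auto intro: set_integrable_subset[OF g])
  show ?thesis
    using Henstock_Kurzweil_Integration.integral_combine[OF assms(1,2) set_borel_integral_eq_integral(1)[OF g]]
    by (simp add: set_borel_integral_eq_integral(2)[OF g] sub[THEN set_borel_integral_eq_integral(2)])
qed

lemma set_integral_Icc_shift:
  fixes g :: "real \<Rightarrow> real"
  shows "(LINT x:{a..b}|lborel. g (c + x)) = (LINT x:{c + a..c + b}|lborel. g x)"
proof -
  have "(LINT x:{c + a..c + b}|lborel. g x) = (\<integral>x. indicator {c + a..c + b} (c + 1 * x) *\<^sub>R g (c + 1 * x) \<partial>lborel)"
    unfolding set_lebesgue_integral_def
    using lborel_integral_real_affine[of 1 "\<lambda>x. indicator {c + a..c + b} x *\<^sub>R g x" c] by simp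
  also have "\<dots> = (LINT x:{a..b}|lborel. g (c + x))"
    unfolding set_lebesgue_integral_def
    by (intro Bochner_Integration.integral_cong) (auto simp: indicator_def)
  finally show ?thesis by simp
qed

text \<open>Isolates the deterministic estimates: for a fixed sample point, \<open>\<phi>\<close>
  will be \<open>\<theta>\<close> times the time integral of \<open>f\<close> along the path, with
  \<open>k = \<bar>\<theta>\<bar> * M\<close>.\<close>

locale lipschitz_path =
  fixes \<phi> :: "real \<Rightarrow> real" and k :: real
  assumes start_zero: "\<phi> 0 = 0"
    and lipschitz: "0 \<le> a \<Longrightarrow> a \<le> b \<Longrightarrow> \<bar>\<phi> b - \<phi> a\<bar> \<le> k * (b - a)"
begin

lemma k_nonneg: "0 \<le> k"
  using order_trans[OF abs_ge_zero lipschitz[of 0 1]] by simp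

lemma abs_path_le: "0 \<le> a \<Longrightarrow> \<bar>\<phi> a\<bar> \<le> k * a"
  using lipschitz[of 0 a] by (simp add: start_zero)

lemma continuous_path: "continuous_on {0..} \<phi>"
proof (rule lipschitz_on_continuous_on)
  show "k-lipschitz_on {0..} \<phi>"
  proof (rule lipschitz_onI)
    fix x y :: real assume "x \<in> {0..}" "y \<in> {0..}"
    then show "dist (\<phi> x) (\<phi> y) \<le> k * dist x y"
      using lipschitz[of x y] lipschitz[of y x] by (cases "x \<le> y") (auto simp: dist_real_def abs_minus_commute)
  qed (rule k_nonneg)
qed

lemma integrable_exp: "0 \<le> a \<Longrightarrow> set_integrable lborel {a..b} (\<lambda>r. exp (\<phi> r))"
  by (intro borel_integrable_atLeastAtMost' continuous_intros continuous_on_subset[OF continuous_path]) auto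

text \<open>On \<open>{c..d}\<close> the path lies above a line of slope \<open>k\<close> or
  \<open>- k\<close>. For the line, the fundamental theorem of calculus makes \<open>k\<close> times
  the integral of the exponential equal to the absolute increment on the left. Passing to the larger
  \<open>\<phi>\<close> and to the larger interval \<open>{0..t}\<close> only increases the
  integral.\<close>

lemma exp_integral_lower:
  assumes "0 \<le> c" "c \<le> d" "d \<le> t" and s: "s = k \<or> s = - k"
    and le: "\<And>r. r \<in> {c..d} \<Longrightarrow> m + s * r \<le> \<phi> r"
  shows "\<bar>exp (m + s * d) - exp (m + s * c)\<bar> \<le> k * (LINT r:{0..t}|lborel. exp (\<phi> r))"
proof -
  have cont: "continuous_on {c..d} (\<lambda>r. s * exp (m + s * r))" by (intro continuous_intros)
  have "(\<integral>r. indicator {c..d} r *\<^sub>R (s * exp (m + s * r)) \<partial>lborel) = exp (m + s * d) - exp (m + s * c)"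
    by (rule integral_FTC_Icc[OF assms(2) _ cont])
       (auto intro!: derivative_eq_intros simp: has_real_derivative_iff_has_vector_derivative[symmetric])
  then have "exp (m + s * d) - exp (m + s * c) = s * (LINT r:{c..d}|lborel. exp (m + s * r))"
    by (simp add: set_lebesgue_integral_def mult.left_commute)
  moreover have "0 \<le> (LINT r:{c..d}|lborel. exp (m + s * r))"
    unfolding set_lebesgue_integral_def by (intro Bochner_Integration.integral_nonneg) auto
  ultimately have "\<bar>exp (m + s * d) - exp (m + s * c)\<bar> = k * (LINT r:{c..d}|lborel. exp (m + s * r))"
    using s k_nonneg by (auto simp: abs_mult)
  also have "(LINT r:{c..d}|lborel. exp (m + s * r)) \<le> (LINT r:{c..d}|lborel. exp (\<phi> r))"
  proof (rule set_integral_mono)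
    show "set_integrable lborel {c..d} (\<lambda>r. exp (m + s * r))"
      by (intro borel_integrable_atLeastAtMost' continuous_intros)
  qed (use le assms integrable_exp in auto)
  also have "(LINT r:{c..d}|lborel. exp (\<phi> r)) \<le> (LINT r:{0..t}|lborel. exp (\<phi> r))"
    unfolding set_lebesgue_integral_def
    using integrable_exp[of c d] integrable_exp[of 0 t] assms
    by (intro integral_mono) (auto simp: set_integrable_def indicator_def)
  finally show ?thesis using k_nonneg by (simp add: mult_left_mono)
qed

text \<open>Since the path is only Lipschitz, there is no fundamental theorem of calculus at hand; instead the
  path is bounded below by a line of slope \<open>k\<close> ending at \<open>\<phi> t\<close> or of slope \<open>- k\<close> starting at \<open>0\<close>.\<close>

lemma abs_exp_minus_1_le:
  assumes t: "0 \<le> t"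
  shows "\<bar>exp (\<phi> t) - 1\<bar> \<le> k * (LINT r:{0..t}|lborel. exp (\<phi> r))"
proof (cases "k = 0")
  case True
  then show ?thesis using abs_path_le[OF t] by simp
next
  case False
  then have k: "0 < k" using k_nonneg by simp
  have b: "\<bar>\<phi> t\<bar> / k \<le> t" using abs_path_le[OF t] k by (simp add: field_simps)
  show ?thesis
  proof (cases "0 \<le> \<phi> t")
    case True
    \<comment> \<open>The line of slope \<open>k\<close> through the endpoint of the path has value
      0 at \<open>t - \<phi> t / k\<close>, and \<open>b\<close> places this point in
      \<open>{0..t}\<close>. The exponential of the line thus climbs from 1 to
      \<open>exp (\<phi> t)\<close>.\<close>
    have "\<bar>exp ((\<phi> t - k * t) + k * t) - exp ((\<phi> t - k * t) + k * (t - \<phi> t / k))\<bar>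
        \<le> k * (LINT r:{0..t}|lborel. exp (\<phi> r))"
    proof (rule exp_integral_lower)
      fix r assume "r \<in> {t - \<phi> t / k..t}"
      then show "\<phi> t - k * t + k * r \<le> \<phi> r"
        using lipschitz[of r t] b True by (auto simp: algebra_simps)
    qed (use b True k in auto)
    then show ?thesis using k by (simp add: algebra_simps)
  next
    case False
    have "\<bar>exp (0 + - k * (- \<phi> t / k)) - exp (0 + - k * 0)\<bar> \<le> k * (LINT r:{0..t}|lborel. exp (\<phi> r))"
    proof (rule exp_integral_lower)
      fix r assume "r \<in> {0..- \<phi> t / k}"
      then show "0 + - k * r \<le> \<phi> r"
        using abs_path_le[of r] by auto
    qed (use b False k in \<open>auto simp: divide_nonpos_pos\<close>)
    then show ?thesis using k by simp
  qed
qed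

lemma exp_path_le:
  assumes "0 \<le> a" "a \<le> T" shows "exp (\<phi> a) \<le> exp (k * T)"
proof -
  have "k * a \<le> k * T" using k_nonneg assms by (intro mult_left_mono)
  then show ?thesis
    using abs_path_le[OF assms(1)] by auto
qed

end

text \<open>A mean value estimate, obtained from the tangent inequality
  \<open>1 + x \<le> exp x\<close> at \<open>x = u - v\<close> after multiplication by
  \<open>exp v\<close>.\<close>

lemma abs_exp_diff_le:
  fixes x y :: real
  assumes "x \<le> m" "y \<le> m" shows "\<bar>exp x - exp y\<bar> \<le> exp m * \<bar>x - y\<bar>"
proof -
  have *: "exp v - exp u \<le> exp m * (v - u)" if "u \<le> v" "v \<le> m" for u v :: real
  proof -
    have "exp v * (1 + (u - v)) \<le> exp v * exp (u - v)"
      by (intro mult_left_mono exp_ge_add_one_self) simp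
    also have "\<dots> = exp u" by (simp add: exp_diff)
    finally have "exp v - exp u \<le> exp v * (v - u)" by (simp add: algebra_simps)
    also have "\<dots> \<le> exp m * (v - u)" using that by (intro mult_right_mono) auto
    finally show ?thesis .
  qed
  show ?thesis using *[of x y] *[of y x] assms by (cases "x \<le> y") (auto simp: abs_if)
qed

text \<open>The tangent inequality at \<open>- x\<close> gives
  \<open>exp x - 1 \<le> exp x * x\<close>, hence
  \<open>exp x - 1 - x \<le> (exp x - 1) * x\<close>, which is quadratic by the preceding
  estimate.\<close>

lemma abs_exp_minus_linear_le:
  fixes x :: real shows "\<bar>exp x - 1 - x\<bar> \<le> exp \<bar>x\<bar> * x\<^sup>2"
proof -
  have "exp x - 1 \<le> exp x * x"
  proof -
    have "exp x * (1 + - x) \<le> exp x * exp (- x)" by (intro mult_left_mono exp_ge_add_one_self) simp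
    then show ?thesis by (simp add: exp_minus algebra_simps)
  qed
  then have "exp x - 1 - x \<le> (exp x - 1) * x" by (simp add: algebra_simps)
  also have "\<dots> \<le> \<bar>exp x - exp 0\<bar> * \<bar>x\<bar>" by (metis abs_ge_self abs_mult exp_zero)
  also have "\<dots> \<le> (exp \<bar>x\<bar> * \<bar>x - 0\<bar>) * \<bar>x\<bar>" by (intro mult_right_mono abs_exp_diff_le) auto
  finally have "exp x - 1 - x \<le> exp \<bar>x\<bar> * x\<^sup>2" by (simp add: power2_eq_square mult.assoc)
  moreover have "0 \<le> exp x - 1 - x" using exp_ge_add_one_self[of x] by linarith
  ultimately show ?thesis by linarith
qed

context lipschitz_path
begin

text \<open>First-order expansion in \<open>\<tau>\<close> of the exponential integral of the
  restarted path, with an explicit quadratic remainder. The increment \<open>\<phi> \<tau>\<close>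
  is kept as it stands, since a Lipschitz path need not have a derivative at 0. \<open>E\<close>
  bounds \<open>exp \<circ> \<phi>\<close> on \<open>{0..t + 1}\<close>.\<close>

lemma shifted_integral_expansion:
  fixes t \<tau> :: real
  defines "Y \<equiv> \<lambda>s. LINT r:{0..s}|lborel. exp (\<phi> r)" and "E \<equiv> exp (k * (t + 1))"
  assumes t: "0 \<le> t" and \<tau>: "0 \<le> \<tau>" "\<tau> \<le> 1"
  shows "\<bar>(LINT r:{0..t}|lborel. exp (\<phi> (\<tau> + r) - \<phi> \<tau>)) - Y t - \<tau> * (exp (\<phi> t) - 1) + \<phi> \<tau> * Y t\<bar>
    \<le> (E\<^sup>2 * k\<^sup>2 * t + 2 * k * E\<^sup>2 + 2 * k * E) * \<tau>\<^sup>2"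
proof -
  have E1: "1 \<le> E" "0 \<le> E" using t k_nonneg by (auto simp: E_def)
  have Eb: "exp (\<phi> a) \<le> E" if "0 \<le> a" "a \<le> t + 1" for a
    unfolding E_def using exp_path_le that by auto
  have lip: "\<bar>exp (\<phi> r) - exp (\<phi> a)\<bar> \<le> E * k * \<tau>" if "0 \<le> a" "a \<le> r" "r \<le> a + \<tau>" "a \<le> t" for a r
  proof -
    have "k * r \<le> k * (t + 1)" "k * a \<le> k * (t + 1)" using k_nonneg that \<tau> by (auto intro!: mult_left_mono)
    then have "\<phi> r \<le> k * (t + 1)" "\<phi> a \<le> k * (t + 1)" using abs_path_le[of r] abs_path_le[of a] that by auto
    then have "\<bar>exp (\<phi> r) - exp (\<phi> a)\<bar> \<le> E * \<bar>\<phi> r - \<phi> a\<bar>" unfolding E_def by (rule abs_exp_diff_le)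
    also have "\<dots> \<le> E * (k * \<tau>)"
    proof (rule mult_left_mono)
      have "\<bar>\<phi> r - \<phi> a\<bar> \<le> k * (r - a)" using lipschitz that by auto
      also have "\<dots> \<le> k * \<tau>" using k_nonneg that by (intro mult_left_mono) auto
      finally show "\<bar>\<phi> r - \<phi> a\<bar> \<le> k * \<tau>" .
    qed (rule E1)
    finally show ?thesis by simp
  qed
  have step: "\<bar>(LINT r:{a..a + \<tau>}|lborel. exp (\<phi> r)) - \<tau> * exp (\<phi> a)\<bar> \<le> E * k * \<tau> * \<tau>" if "0 \<le> a" "a \<le> t" for a
  proof -
    have "(LINT r:{a..a + \<tau>}|lborel. exp (\<phi> r) - exp (\<phi> a)) = (LINT r:{a..a + \<tau>}|lborel. exp (\<phi> r)) - (LINT r:{a..a + \<tau>}|lborel. exp (\<phi> a))"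
      by (rule set_integral_diff(2)) (use that in \<open>auto intro: integrable_exp set_integrable_const_Icc\<close>)
    moreover have "(LINT r:{a..a + \<tau>}|lborel. exp (\<phi> a)) = \<tau> * exp (\<phi> a)"
      using \<tau> by (simp add: set_lebesgue_integral_def)
    moreover have "\<bar>LINT r:{a..a + \<tau>}|lborel. exp (\<phi> r) - exp (\<phi> a)\<bar> \<le> E * k * \<tau> * ((a + \<tau>) - a)"
      using \<tau> that by (intro abs_set_integral_Icc_le lip) auto
    ultimately show ?thesis by simp
  qed
  \<comment> \<open>Moving the window from \<open>{0..t}\<close> to
    \<open>{\<tau>..\<tau> + t}\<close> gains the piece beyond \<open>t\<close> and loses the piece
    before \<open>\<tau>\<close>. By \<open>step\<close>, \<open>D\<close> equals
    \<open>\<tau> * (exp (\<phi> t) - 1)\<close> up to second order.\<close>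
  define D where "D = (LINT r:{t..t + \<tau>}|lborel. exp (\<phi> r)) - (LINT r:{0..\<tau>}|lborel. exp (\<phi> r))"
  have Yt: "\<bar>Y t\<bar> \<le> E * t"
  proof -
    have "\<bar>Y t\<bar> \<le> E * (t - 0)" unfolding Y_def using Eb t by (intro abs_set_integral_Icc_le) auto
    then show ?thesis by simp
  qed
  have D2: "\<bar>D - \<tau> * (exp (\<phi> t) - 1)\<bar> \<le> 2 * k * E * \<tau>\<^sup>2"
    using step[of t] step[of 0] t by (simp add: D_def start_zero power2_eq_square algebra_simps)
  have D1: "\<bar>D\<bar> \<le> 2 * E * \<tau>"
  proof -
    have "\<bar>LINT r:{t..t + \<tau>}|lborel. exp (\<phi> r)\<bar> \<le> E * ((t + \<tau>) - t)" "\<bar>LINT r:{0..\<tau>}|lborel. exp (\<phi> r)\<bar> \<le> E * (\<tau> - 0)"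
      using Eb t \<tau> by (intro abs_set_integral_Icc_le; auto)+
    then show ?thesis by (simp add: D_def)
  qed
  have "(LINT r:{0..t}|lborel. exp (\<phi> (\<tau> + r) - \<phi> \<tau>)) = exp (- \<phi> \<tau>) * (LINT r:{0..t}|lborel. exp (\<phi> (\<tau> + r)))"
    by (simp add: exp_diff exp_minus divide_inverse mult.commute)
  also have "(LINT r:{0..t}|lborel. exp (\<phi> (\<tau> + r))) = (LINT r:{\<tau>..\<tau> + t}|lborel. exp (\<phi> r))"
    by (subst set_integral_Icc_shift[where g="\<lambda>r. exp (\<phi> r)"]) simp
  also have "\<dots> = Y t + D"
  proof -
    have "Y (\<tau> + t) = (LINT r:{0..\<tau>}|lborel. exp (\<phi> r)) + (LINT r:{\<tau>..\<tau> + t}|lborel. exp (\<phi> r))"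
      unfolding Y_def using t \<tau> by (intro set_integral_Icc_combine integrable_exp) auto
    moreover have "Y (\<tau> + t) = Y t + (LINT r:{t..\<tau> + t}|lborel. exp (\<phi> r))"
      unfolding Y_def using t \<tau> by (intro set_integral_Icc_combine integrable_exp) auto
    ultimately show ?thesis by (simp add: D_def add.commute)
  qed
  finally have main: "(LINT r:{0..t}|lborel. exp (\<phi> (\<tau> + r) - \<phi> \<tau>)) = exp (- \<phi> \<tau>) * (Y t + D)" .
  have p\<tau>: "\<bar>\<phi> \<tau>\<bar> \<le> k * \<tau>" using abs_path_le \<tau> by auto
  have eE: "exp \<bar>- \<phi> \<tau>\<bar> \<le> E"
  proof -
    have "k * \<tau> \<le> k * (t + 1)" using t \<tau> k_nonneg by (intro mult_left_mono) auto
    with p\<tau> show ?thesis by (simp add: E_def)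
  qed
  have e2: "\<bar>exp (- \<phi> \<tau>) - 1 + \<phi> \<tau>\<bar> \<le> E * (k * \<tau>)\<^sup>2"
  proof -
    have "\<bar>exp (- \<phi> \<tau>) - 1 + \<phi> \<tau>\<bar> \<le> exp \<bar>- \<phi> \<tau>\<bar> * (- \<phi> \<tau>)\<^sup>2"
      using abs_exp_minus_linear_le[of "- \<phi> \<tau>"] by simp
    also have "\<dots> \<le> E * (k * \<tau>)\<^sup>2"
      using eE p\<tau> E1 by (intro mult_mono) (auto intro!: abs_le_square_iff[THEN iffD1])
    finally show ?thesis .
  qed
  have e1: "\<bar>exp (- \<phi> \<tau>) - 1\<bar> \<le> E * (k * \<tau>)"
  proof -
    have "\<bar>exp (- \<phi> \<tau>) - exp 0\<bar> \<le> exp \<bar>- \<phi> \<tau>\<bar> * \<bar>- \<phi> \<tau> - 0\<bar>" by (rule abs_exp_diff_le) auto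
    also have "\<dots> \<le> E * (k * \<tau>)" using eE p\<tau> E1 by (intro mult_mono) auto
    finally show ?thesis by simp
  qed
  \<comment> \<open>The product of two first-order expansions. The three error terms are controlled
    by \<open>e2\<close> with \<open>Yt\<close>, by \<open>e1\<close> with \<open>D1\<close>, and by
    \<open>D2\<close>; they yield the three summands of the constant in this order.\<close>
  have "exp (- \<phi> \<tau>) * (Y t + D) - Y t - \<tau> * (exp (\<phi> t) - 1) + \<phi> \<tau> * Y t
    = (exp (- \<phi> \<tau>) - 1 + \<phi> \<tau>) * Y t + (exp (- \<phi> \<tau>) - 1) * D + (D - \<tau> * (exp (\<phi> t) - 1))"
    by (simp add: algebra_simps)
  also have "\<bar>\<dots>\<bar> \<le> \<bar>(exp (- \<phi> \<tau>) - 1 + \<phi> \<tau>) * Y t\<bar> + \<bar>(exp (- \<phi> \<tau>) - 1) * D\<bar> + \<bar>D - \<tau> * (exp (\<phi> t) - 1)\<bar>"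
    by linarith
  also have "\<dots> \<le> (E * (k * \<tau>)\<^sup>2) * (E * t) + (E * (k * \<tau>)) * (2 * E * \<tau>) + 2 * k * E * \<tau>\<^sup>2"
    unfolding abs_mult using k_nonneg E1 \<tau> by (intro add_mono mult_mono e1 e2 D1 D2 Yt) auto
  also have "\<dots> = (E\<^sup>2 * k\<^sup>2 * t + 2 * k * E\<^sup>2 + 2 * k * E) * \<tau>\<^sup>2"
    by (simp add: algebra_simps power2_eq_square)
  finally show ?thesis unfolding main .
qed

end

subsection \<open>Exponential moments of the additive functional\<close>

locale additive_functional = markov_process W P Z
  for W :: "'w measure" and P :: "'a::polish_space \<Rightarrow> 'w measure" and Z :: "real \<Rightarrow> 'w \<Rightarrow> 'a" +
  fixes f :: "'a \<Rightarrow> real" and M :: real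
  assumes f_measurable [measurable]: "f \<in> borel_measurable borel"
    and f_bounded: "\<bar>f z\<bar> \<le> M"
    and f_joint: "(\<lambda>(s, \<omega>). f (Z s \<omega>)) \<in> borel_measurable (restrict_space borel {0..} \<Otimes>\<^sub>M W)"
begin

text \<open>The window has length \<open>r\<close> and begins at \<open>\<tau>\<close>: this is the
  additive functional over time \<open>r\<close> of the path shifted by
  \<open>\<tau>\<close>.\<close>

definition additive :: "real \<Rightarrow> real \<Rightarrow> 'w \<Rightarrow> real" where
  "additive \<tau> r \<omega> = (LINT v:{0..r}|lborel. f (Z (\<tau> + v) \<omega>))"

lemma M_nonneg: "0 \<le> M"
  using order_trans[OF abs_ge_zero f_bounded] .

text \<open>Negative times carry no information about \<open>Z\<close>, so the path is extended
  constantly to the left by \<open>max 0 v\<close>; joint measurability then holds on the whole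
  line.\<close>

lemma measurable_path:
  "(\<lambda>(v, \<omega>). f (Z (max 0 v) \<omega>)) \<in> borel_measurable (borel \<Otimes>\<^sub>M W)"
proof -
  have "(\<lambda>(v::real, \<omega>). (max 0 v, \<omega>)) \<in> borel \<Otimes>\<^sub>M W \<rightarrow>\<^sub>M restrict_space borel {0..} \<Otimes>\<^sub>M W"
    unfolding split_beta' by (intro measurable_Pair measurable_restrict_space2) auto
  from measurable_compose[OF this f_joint] show ?thesis by (simp add: split_beta')
qed

lemma measurable_path_shift:
  assumes "0 \<le> \<tau>" "sets N = sets W"
  shows "(\<lambda>(v, \<omega>). f (Z (\<tau> + max 0 v) \<omega>)) \<in> borel_measurable (borel \<Otimes>\<^sub>M N)"
proof -
  have "(\<lambda>(v::real, \<omega>). (\<tau> + max 0 v, \<omega>)) \<in> borel \<Otimes>\<^sub>M W \<rightarrow>\<^sub>M borel \<Otimes>\<^sub>M W"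
    unfolding split_beta' by measurable
  from measurable_compose[OF this measurable_path] have
    "(\<lambda>(v, \<omega>). f (Z (\<tau> + max 0 v) \<omega>)) \<in> borel_measurable (borel \<Otimes>\<^sub>M W)"
    using assms by (simp add: split_beta' max_def)
  then show ?thesis
    using assms(2) by (simp cong: measurable_cong_sets sets_pair_measure_cong)
qed

lemma set_integrable_path:
  assumes "\<omega> \<in> space W" "0 \<le> a" shows "set_integrable lborel {a..b} (\<lambda>v. f (Z v \<omega>))"
proof -
  have "(\<lambda>v. f (Z (max 0 v) \<omega>)) \<in> borel_measurable borel"
    using measurable_compose[OF measurable_Pair2'[OF assms(1)] measurable_path] by simp
  then have "set_integrable lborel {a..b} (\<lambda>v. f (Z (max 0 v) \<omega>))"
    unfolding set_integrable_def using f_bounded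
    by (intro integrableI_bounded_set_indicator[where B=M]) (auto simp: emeasure_lborel_Icc_eq)
  then show ?thesis
    by (rule set_integrable_cong[THEN iffD1, rotated -1]) (use assms in auto)
qed

lemma additive_eq_diff:
  assumes "\<omega> \<in> space W" "0 \<le> \<tau>" "0 \<le> r"
  shows "additive \<tau> r \<omega> = additive 0 (\<tau> + r) \<omega> - additive 0 \<tau> \<omega>"
proof -
  have "additive \<tau> r \<omega> = (LINT v:{\<tau>..\<tau> + r}|lborel. f (Z v \<omega>))"
    unfolding additive_def by (subst set_integral_Icc_shift[where g="\<lambda>v. f (Z v \<omega>)"]) simp
  moreover have "(LINT v:{0..\<tau> + r}|lborel. f (Z v \<omega>)) = (LINT v:{0..\<tau>}|lborel. f (Z v \<omega>)) + (LINT v:{\<tau>..\<tau> + r}|lborel. f (Z v \<omega>))"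
    using assms by (intro set_integral_Icc_combine set_integrable_path) auto
  ultimately show ?thesis by (simp add: additive_def)
qed

lemma abs_additive_le: "0 \<le> r \<Longrightarrow> \<bar>additive \<tau> r \<omega>\<bar> \<le> M * r"
  using abs_set_integral_Icc_le[of 0 r "\<lambda>v. f (Z (\<tau> + v) \<omega>)" M] f_bounded by (simp add: additive_def)

lemma lipschitz_path_additive:
  assumes "\<omega> \<in> space W" shows "lipschitz_path (\<lambda>r. \<theta> * additive 0 r \<omega>) (\<bar>\<theta>\<bar> * M)"
proof
  show "\<theta> * additive 0 0 \<omega> = 0" using abs_additive_le[of 0 0 \<omega>] by simp
  fix a b :: real assume "0 \<le> a" "a \<le> b"
  then have "\<bar>additive 0 b \<omega> - additive 0 a \<omega>\<bar> \<le> M * (b - a)"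
    using additive_eq_diff[OF assms, of a "b - a"] abs_additive_le[of "b - a" a \<omega>] by simp
  then have "\<bar>\<theta>\<bar> * \<bar>additive 0 b \<omega> - additive 0 a \<omega>\<bar> \<le> \<bar>\<theta>\<bar> * (M * (b - a))"
    by (rule mult_left_mono) simp
  then show "\<bar>\<theta> * additive 0 b \<omega> - \<theta> * additive 0 a \<omega>\<bar> \<le> \<bar>\<theta>\<bar> * M * (b - a)"
    by (simp add: abs_mult right_diff_distrib[symmetric] mult.assoc)
qed

text \<open>The length \<open>r\<close> is a variable too. The integrand is therefore cut off on the
  measurable set \<open>0 \<le> v \<le> r\<close> of the triple product, and \<open>v\<close> is
  integrated out.\<close>

lemma measurable_additive_pair:
  assumes "0 \<le> \<tau>" "sets N = sets W"
  shows "(\<lambda>(r, \<omega>). additive \<tau> r \<omega>) \<in> borel_measurable (borel \<Otimes>\<^sub>M N)"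
proof -
  have "(\<lambda>((r::real, \<omega>), v::real). (v, \<omega>)) \<in> (borel \<Otimes>\<^sub>M N) \<Otimes>\<^sub>M lborel \<rightarrow>\<^sub>M borel \<Otimes>\<^sub>M N"
    unfolding split_beta' by measurable
  from measurable_compose[OF this measurable_path_shift[OF assms]]
  have path: "(\<lambda>x. f (Z (\<tau> + max 0 (snd x)) (snd (fst x)))) \<in> borel_measurable (((borel :: real measure) \<Otimes>\<^sub>M N) \<Otimes>\<^sub>M lborel)"
    by (simp add: split_beta')
  have snd: "snd \<in> borel_measurable (((borel :: real measure) \<Otimes>\<^sub>M N) \<Otimes>\<^sub>M (lborel :: real measure))"
    using measurable_snd[of "(borel :: real measure) \<Otimes>\<^sub>M N" "lborel :: real measure"] by simp
  have fst: "(\<lambda>x. fst (fst x)) \<in> borel_measurable (((borel :: real measure) \<Otimes>\<^sub>M N) \<Otimes>\<^sub>M (lborel :: real measure))"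
    by measurable
  note [measurable] = snd fst
  have pred: "{x \<in> space ((borel \<Otimes>\<^sub>M N) \<Otimes>\<^sub>M lborel). 0 \<le> snd x \<and> snd x \<le> fst (fst x)}
      \<in> sets (((borel :: real measure) \<Otimes>\<^sub>M N) \<Otimes>\<^sub>M (lborel :: real measure))"
    by measurable
  have "(\<lambda>x. \<integral>v. (if 0 \<le> v \<and> v \<le> fst x then f (Z (\<tau> + max 0 v) (snd x)) else 0) \<partial>lborel)
      \<in> borel_measurable (borel \<Otimes>\<^sub>M N)"
    using measurable_If[OF path measurable_const pred, of 0]
    by (intro lborel.borel_measurable_lebesgue_integral) (simp add: split_beta')
  also have "(\<lambda>x. \<integral>v. (if 0 \<le> v \<and> v \<le> fst x then f (Z (\<tau> + max 0 v) (snd x)) else 0) \<partial>lborel)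
      = (\<lambda>(r, \<omega>). additive \<tau> r \<omega>)"
    by (auto simp: fun_eq_iff additive_def set_lebesgue_integral_def intro!: Bochner_Integration.integral_cong)
  finally show ?thesis .
qed

lemma measurable_additive [measurable]:
  assumes "0 \<le> \<tau>" shows "additive \<tau> r \<in> borel_measurable W"
  by (rule measurable_Pair_compose_split[OF measurable_additive_pair[OF assms refl], of "\<lambda>_. r" W "\<lambda>\<omega>. \<omega>"]) auto

text \<open>The time integral is measurable on \<open>W\<close> but possibly not with respect to the process algebra, so
  the Markov property is carried over to it through mixed moments with cylinder functions.\<close>

lemma additive_power_markov:
  assumes \<tau>: "0 \<le> \<tau>" and r: "0 \<le> r" and "cylinder_data L"
  shows "(\<integral>\<omega>. additive \<tau> r \<omega> ^ n * cylinder Z \<tau> L \<omega> \<partial>P z)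
    = (\<integral>\<omega>. additive 0 r \<omega> ^ n * cylinder Z 0 L \<omega> \<partial>restarted z \<tau>)"
  using assms(3)
proof (induction n arbitrary: L)
  case 0
  then show ?case using cylinder_markov[OF \<tau>] by simp
next
  case (Suc n)
  obtain C where C: "\<And>\<tau> \<omega>. \<bar>cylinder Z \<tau> L \<omega>\<bar> \<le> C" using cylinder_bounded[OF Suc.prems, where Z=Z] by blast
  \<comment> \<open>One factor of the power is written as a time integral and exchanged with the
    expectation. The observable \<open>f\<close> at time \<open>v\<close> joins the cylinder
    function, so the exponent drops by one. The step is used for \<open>P z\<close> at offset
    \<open>\<tau>\<close> and for the restarted law at offset 0.\<close>
  have step: "(\<integral>\<omega>. additive \<tau>' r \<omega> ^ Suc n * cylinder Z \<tau>' L \<omega> \<partial>N)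
      = (LINT v:{0..r}|lborel. \<integral>\<omega>. additive \<tau>' r \<omega> ^ n * cylinder Z \<tau>' ((v, f) # L) \<omega> \<partial>N)"
    if \<tau>': "0 \<le> \<tau>'" and N: "prob_space N" "sets N = sets W" for N \<tau>'
  proof -
    have [measurable]: "additive \<tau>' r \<in> borel_measurable N" "cylinder Z \<tau>' L \<in> borel_measurable N"
      using measurable_additive[OF \<tau>', of r] measurable_cylinder[OF \<tau>' Suc.prems]
      by (auto simp: measurable_cong_sets[OF N(2) refl])
    note [measurable] = measurable_path_shift[OF \<tau>' N(2)]
    have "(\<integral>\<omega>. additive \<tau>' r \<omega> ^ Suc n * cylinder Z \<tau>' L \<omega> \<partial>N)
      = (\<integral>\<omega>. (LINT v:{0..r}|lborel. f (Z (\<tau>' + max 0 v) \<omega>) * (additive \<tau>' r \<omega> ^ n * cylinder Z \<tau>' L \<omega>)) \<partial>N)"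
    proof (rule Bochner_Integration.integral_cong[OF refl])
      fix \<omega>
      have "additive \<tau>' r \<omega> = (LINT v:{0..r}|lborel. f (Z (\<tau>' + max 0 v) \<omega>))"
        unfolding additive_def by (intro set_lebesgue_integral_cong) auto
      then show "additive \<tau>' r \<omega> ^ Suc n * cylinder Z \<tau>' L \<omega>
        = (LINT v:{0..r}|lborel. f (Z (\<tau>' + max 0 v) \<omega>) * (additive \<tau>' r \<omega> ^ n * cylinder Z \<tau>' L \<omega>))"
        by (simp add: mult.assoc)
    qed
    also have "\<dots> = (LINT v:{0..r}|lborel. \<integral>\<omega>. f (Z (\<tau>' + max 0 v) \<omega>) * (additive \<tau>' r \<omega> ^ n * cylinder Z \<tau>' L \<omega>) \<partial>N)"
    proof (rule set_integral_fubini_bounded[OF N(1)])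
      show "\<bar>f (Z (\<tau>' + max 0 v) \<omega>) * (additive \<tau>' r \<omega> ^ n * cylinder Z \<tau>' L \<omega>)\<bar> \<le> M * ((M * r) ^ n * C)" for v \<omega>
        unfolding abs_mult power_abs using M_nonneg r
        by (intro mult_mono f_bounded power_mono abs_additive_le C) auto
    qed measurable
    also have "\<dots> = (LINT v:{0..r}|lborel. \<integral>\<omega>. additive \<tau>' r \<omega> ^ n * cylinder Z \<tau>' ((v, f) # L) \<omega> \<partial>N)"
      by (intro set_lebesgue_integral_cong) (auto simp: mult_ac)
    finally show ?thesis .
  qed
  have "(LINT v:{0..r}|lborel. \<integral>\<omega>. additive \<tau> r \<omega> ^ n * cylinder Z \<tau> ((v, f) # L) \<omega> \<partial>P z)
    = (LINT v:{0..r}|lborel. \<integral>\<omega>. additive 0 r \<omega> ^ n * cylinder Z 0 ((v, f) # L) \<omega> \<partial>restarted z \<tau>)"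
  proof (rule set_lebesgue_integral_cong)
    have "cylinder_data ((v, f) # L)" if "0 \<le> v" for v
      using that Suc.prems f_bounded by (auto intro!: exI[of _ M])
    from Suc.IH[OF this] show "\<forall>v. v \<in> {0..r} \<longrightarrow>
        (\<integral>\<omega>. additive \<tau> r \<omega> ^ n * cylinder Z \<tau> ((v, f) # L) \<omega> \<partial>P z)
        = (\<integral>\<omega>. additive 0 r \<omega> ^ n * cylinder Z 0 ((v, f) # L) \<omega> \<partial>restarted z \<tau>)"
      by (simp del: cylinder_simps)
  qed simp
  then show ?case
    using step[OF \<tau> prob_space_P sets_P] step[OF order_refl prob_space_restarted[OF \<tau>] sets_restarted[OF \<tau>]] by simp
qed

text \<open>As \<open>\<bar>additive \<tau> r \<omega>\<bar> \<le> M * r\<close>, the exponential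
  series is dominated by that of \<open>\<bar>\<theta>\<bar> * (M * r)\<close> and may be integrated
  termwise. Exponential moments are thus determined by power moments.\<close>

lemma additive_exp_series:
  assumes \<tau>: "0 \<le> \<tau>" and r: "0 \<le> r" and N: "prob_space N" "sets N = sets W"
  shows "(\<integral>\<omega>. exp (\<theta> * additive \<tau> r \<omega>) \<partial>N) = (\<Sum>n. (\<theta> ^ n / fact n) * (\<integral>\<omega>. additive \<tau> r \<omega> ^ n \<partial>N))"
proof -
  interpret N: prob_space N by fact
  have [measurable]: "additive \<tau> r \<in> borel_measurable N"
    using measurable_additive[OF \<tau>, of r] by (simp add: measurable_cong_sets[OF N(2) refl])
  define b where "b = (\<lambda>n. (\<bar>\<theta>\<bar> * (M * r)) ^ n / fact n)"
  have b: "summable b" unfolding b_def using summable_exp[of "\<bar>\<theta>\<bar> * (M * r)"] by (simp add: divide_inverse mult.commute)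
  have le: "norm (\<theta> ^ n / fact n * additive \<tau> r \<omega> ^ n) \<le> b n" for n \<omega>
  proof -
    have "norm (\<theta> ^ n / fact n * additive \<tau> r \<omega> ^ n) = (\<bar>\<theta>\<bar> * \<bar>additive \<tau> r \<omega>\<bar>) ^ n / fact n"
      by (simp add: abs_mult power_abs power_mult_distrib)
    also have "\<dots> \<le> b n"
      unfolding b_def using r by (intro divide_right_mono power_mono mult_left_mono abs_additive_le) auto
    finally show ?thesis .
  qed
  have int: "integrable N (\<lambda>\<omega>. \<theta> ^ n / fact n * additive \<tau> r \<omega> ^ n)" for n
    using le by (intro N.integrable_const_bound[where B="b n"] AE_I2) auto
  have "(\<integral>\<omega>. exp (\<theta> * additive \<tau> r \<omega>) \<partial>N) = (\<integral>\<omega>. (\<Sum>n. \<theta> ^ n / fact n * additive \<tau> r \<omega> ^ n) \<partial>N)"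
    by (simp add: exp_def power_mult_distrib divide_inverse mult_ac)
  also have "\<dots> = (\<Sum>n. \<integral>\<omega>. \<theta> ^ n / fact n * additive \<tau> r \<omega> ^ n \<partial>N)"
  proof (rule integral_suminf[OF int])
    show "AE \<omega> in N. summable (\<lambda>n. norm (\<theta> ^ n / fact n * additive \<tau> r \<omega> ^ n))"
      using le by (intro AE_I2 summable_comparison_test'[OF b, where N=0]) auto
    have "\<bar>\<integral>\<omega>. norm (\<theta> ^ n / fact n * additive \<tau> r \<omega> ^ n) \<partial>N\<bar> \<le> b n" for n
      using le by (intro abs_integral_le_prob N) auto
    then show "summable (\<lambda>n. \<integral>\<omega>. norm (\<theta> ^ n / fact n * additive \<tau> r \<omega> ^ n) \<partial>N)"
      by (intro summable_comparison_test'[OF b, where N=0]) auto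
  qed
  finally show ?thesis by simp
qed

text \<open>All power moments agree by \<open>additive_power_markov\<close> with the empty cylinder,
  hence so do the exponential series.\<close>

lemma additive_exp_markov:
  assumes \<tau>: "0 \<le> \<tau>" and r: "0 \<le> r"
  shows "(\<integral>\<omega>. exp (\<theta> * additive \<tau> r \<omega>) \<partial>P z) = (\<integral>\<omega>. exp (\<theta> * additive 0 r \<omega>) \<partial>restarted z \<tau>)"
  using additive_power_markov[OF \<tau> r, of "[]"]
  by (simp add: additive_exp_series[OF \<tau> r prob_space_P sets_P]
      additive_exp_series[OF order_refl r prob_space_restarted[OF \<tau>] sets_restarted[OF \<tau>]])

lemma exp_additive_le: "0 \<le> r \<Longrightarrow> r \<le> T \<Longrightarrow> exp (\<theta> * additive \<tau> r \<omega>) \<le> exp (\<bar>\<theta>\<bar> * M * T)"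
proof -
  assume r: "0 \<le> r" "r \<le> T"
  have "\<theta> * additive \<tau> r \<omega> \<le> \<bar>\<theta>\<bar> * \<bar>additive \<tau> r \<omega>\<bar>" by (metis abs_ge_self abs_mult)
  also have "\<dots> \<le> \<bar>\<theta>\<bar> * (M * T)"
    using abs_additive_le[OF r(1), of \<tau> \<omega>] mult_left_mono[OF r(2) M_nonneg] by (intro mult_left_mono) auto
  finally show ?thesis by (simp add: mult.assoc)
qed

section \<open>Exponential moments and their time integrals\<close>

definition mgf :: "real \<Rightarrow> real \<Rightarrow> 'a \<Rightarrow> real" where
  "mgf \<theta> t z = (\<integral>\<omega>. exp (\<theta> * additive 0 t \<omega>) \<partial>P z)"

definition exp_integral :: "real \<Rightarrow> real \<Rightarrow> real \<Rightarrow> 'w \<Rightarrow> real" where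
  "exp_integral \<theta> \<tau> t \<omega> = (LINT r:{0..t}|lborel. exp (\<theta> * additive \<tau> r \<omega>))"

text \<open>By Fubini this is the integral of \<open>mgf \<theta> r z\<close> over \<open>r\<close>
  from 0 to \<open>t\<close>: a resolvent truncated at time \<open>t\<close> of the Feynman-Kac
  semigroup with potential \<open>\<theta> * f\<close>, applied to the constant 1.\<close>

definition resolvent :: "real \<Rightarrow> real \<Rightarrow> 'a \<Rightarrow> real" where
  "resolvent \<theta> t z = (\<integral>\<omega>. exp_integral \<theta> 0 t \<omega> \<partial>P z)"

lemma exp_integral_fubini:
  assumes "0 \<le> \<tau>" "prob_space N" "sets N = sets W"
  shows "(\<integral>\<omega>. exp_integral \<theta> \<tau> t \<omega> \<partial>N) = (LINT r:{0..t}|lborel. \<integral>\<omega>. exp (\<theta> * additive \<tau> r \<omega>) \<partial>N)"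
  unfolding exp_integral_def
proof (rule set_integral_fubini_bounded[OF assms(2)])
  note [measurable] = measurable_additive_pair[OF assms(1,3)]
  show "(\<lambda>(v, \<omega>). exp (\<theta> * additive \<tau> v \<omega>)) \<in> borel_measurable (borel \<Otimes>\<^sub>M N)"
    by measurable
  show "\<bar>exp (\<theta> * additive \<tau> v \<omega>)\<bar> \<le> exp (\<bar>\<theta>\<bar> * M * t)" if "v \<in> {0..t}" for v \<omega>
    using exp_additive_le[of v t] that by simp
qed

lemma exp_integral_bounds:
  assumes "0 \<le> t"
  shows "0 \<le> exp_integral \<theta> \<tau> t \<omega>" "exp_integral \<theta> \<tau> t \<omega> \<le> exp (\<bar>\<theta>\<bar> * M * t) * t"
proof -
  show "0 \<le> exp_integral \<theta> \<tau> t \<omega>"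
    unfolding exp_integral_def set_lebesgue_integral_def by (intro Bochner_Integration.integral_nonneg) auto
  have "\<bar>exp_integral \<theta> \<tau> t \<omega>\<bar> \<le> exp (\<bar>\<theta>\<bar> * M * t) * (t - 0)"
    unfolding exp_integral_def using exp_additive_le[where T=t]
    by (intro abs_set_integral_Icc_le assms) auto
  then show "exp_integral \<theta> \<tau> t \<omega> \<le> exp (\<bar>\<theta>\<bar> * M * t) * t" by simp
qed

lemma measurable_exp_integral [measurable]:
  assumes "0 \<le> \<tau>" shows "exp_integral \<theta> \<tau> t \<in> borel_measurable W"
proof -
  note [measurable] = measurable_additive_pair[OF assms sets_P]
  have "(\<lambda>(v, \<omega>). exp (\<theta> * additive \<tau> v \<omega>)) \<in> borel_measurable (borel \<Otimes>\<^sub>M P undefined)"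
    by measurable
  from borel_measurable_set_lebesgue_integral[OF _ this]
  show ?thesis
    using prob_space_P[of undefined]
    by (simp add: exp_integral_def[abs_def] measurable_P_iff prob_space_imp_sigma_finite)
qed

text \<open>After Fubini only exponential moments over single windows occur. For these,
  \<open>additive_exp_markov\<close> identifies the restarted law with the path shifted by
  \<open>\<tau>\<close>.\<close>

lemma semigroup_resolvent:
  assumes \<tau>: "0 \<le> \<tau>" and t: "0 \<le> t"
  shows "semigroup P Z \<tau> (resolvent \<theta> t) z = (\<integral>\<omega>. exp_integral \<theta> \<tau> t \<omega> \<partial>P z)"
proof -
  have "semigroup P Z \<tau> (resolvent \<theta> t) z = (\<integral>\<omega>. exp_integral \<theta> 0 t \<omega> \<partial>restarted z \<tau>)"
    unfolding semigroup_def resolvent_def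
    using exp_integral_bounds[OF t] \<tau> measurable_exp_integral[OF order_refl]
    by (intro integral_restarted[symmetric, where C="exp (\<bar>\<theta>\<bar> * M * t) * t"]) auto
  also have "\<dots> = (LINT r:{0..t}|lborel. \<integral>\<omega>. exp (\<theta> * additive 0 r \<omega>) \<partial>restarted z \<tau>)"
    by (intro exp_integral_fubini prob_space_restarted sets_restarted \<tau> order_refl)
  also have "\<dots> = (LINT r:{0..t}|lborel. \<integral>\<omega>. exp (\<theta> * additive \<tau> r \<omega>) \<partial>P z)"
    using \<tau> by (intro set_lebesgue_integral_cong) (auto simp: additive_exp_markov)
  also have "\<dots> = (\<integral>\<omega>. exp_integral \<theta> \<tau> t \<omega> \<partial>P z)"
    by (intro exp_integral_fubini[symmetric] prob_space_P sets_P \<tau>)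
  finally show ?thesis .
qed

end

subsection \<open>The generator of the truncated resolvent\<close>

context additive_functional
begin

text \<open>Weak right-continuity only concerns factors measurable with respect to the process algebra; a general
  factor is replaced by its conditional expectation, clipped because it is bounded only almost everywhere.\<close>

lemma averaged_right_limit:
  assumes rc: "weakly_right_continuous W P Z f"
    and \<Phi>[measurable]: "\<Phi> \<in> borel_measurable W" and C: "\<And>\<omega>. \<omega> \<in> space W \<Longrightarrow> \<bar>\<Phi> \<omega>\<bar> \<le> C"
  shows "((\<lambda>\<tau>. (\<integral>\<omega>. additive 0 \<tau> \<omega> * \<Phi> \<omega> \<partial>P z) / \<tau>) \<longlongrightarrow> f z * (\<integral>\<omega>. \<Phi> \<omega> \<partial>P z)) (at_right 0)"
proof -
  interpret Pz: prob_space "P z" by (rule prob_space_P)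
  define A where "A = process_algebra W Z {0..}"
  interpret A: finite_measure_subalgebra "P z" A
    unfolding A_def by unfold_locales (rule subalgebra_process_algebra, auto)
  have Zm[measurable]: "Z v \<in> W \<rightarrow>\<^sub>M borel" "Z v \<in> A \<rightarrow>\<^sub>M borel" if "0 \<le> v" for v
    using that by (auto simp: A_def intro: process_measurable process_measurable_algebra)
  have int\<Phi>: "integrable (P z) \<Phi>" using C by (intro integrable_P) auto
  define X0 where "X0 = real_cond_exp (P z) A \<Phi>"
  define X where "X = (\<lambda>\<omega>. max (- C) (min C (X0 \<omega>)))"
  have [measurable]: "X0 \<in> borel_measurable A" by (simp add: X0_def)
  have X[measurable]: "X \<in> borel_measurable A" unfolding X_def by measurable
  have X0W[measurable]: "X0 \<in> borel_measurable W" and XW[measurable]: "X \<in> borel_measurable W"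
    using measurable_from_subalg[OF A.subalg \<open>X0 \<in> borel_measurable A\<close>] measurable_from_subalg[OF A.subalg X]
    by (simp_all add: measurable_P_iff)
  have "0 \<le> C" using C Pz.not_empty space_P[of z] by force
  then have X_le: "\<bar>X \<omega>\<bar> \<le> C" for \<omega> by (auto simp: X_def)
  have "AE \<omega> in P z. X0 \<omega> \<le> C" "AE \<omega> in P z. - C \<le> X0 \<omega>"
    unfolding X0_def
    by (intro A.real_cond_exp_le_c A.real_cond_exp_ge_c int\<Phi> AE_I2; use C in \<open>force simp: space_P abs_le_iff\<close>)+
  then have AE: "AE \<omega> in P z. X0 \<omega> = X \<omega>" by eventually_elim (auto simp: X_def)
  have proj: "(\<integral>\<omega>. g \<omega> * \<Phi> \<omega> \<partial>P z) = (\<integral>\<omega>. g \<omega> * X \<omega> \<partial>P z)"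
    if g: "g \<in> borel_measurable A" "\<And>\<omega>. \<bar>g \<omega>\<bar> \<le> B" for g B
  proof -
    have [measurable]: "g \<in> borel_measurable W"
      using measurable_from_subalg[OF A.subalg g(1)] by (simp add: measurable_P_iff)
    have "integrable (P z) (\<lambda>\<omega>. g \<omega> * \<Phi> \<omega>)"
    proof (rule integrable_P)
      show "\<bar>g \<omega> * \<Phi> \<omega>\<bar> \<le> B * C" if "\<omega> \<in> space W" for \<omega>
        unfolding abs_mult using g(2) C[OF that] order_trans[OF abs_ge_zero g(2)] by (intro mult_mono) auto
    qed measurable
    then have "(\<integral>\<omega>. g \<omega> * \<Phi> \<omega> \<partial>P z) = (\<integral>\<omega>. g \<omega> * X0 \<omega> \<partial>P z)"
      unfolding X0_def by (intro A.real_cond_exp_intg(2)[symmetric] g(1)) (auto simp: measurable_P_iff)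
    also have "\<dots> = (\<integral>\<omega>. g \<omega> * X \<omega> \<partial>P z)"
      by (rule integral_cong_AE) (use AE in \<open>auto simp: measurable_P_iff\<close>)
    finally show ?thesis .
  qed
  define L where "L = f z * (\<integral>\<omega>. \<Phi> \<omega> \<partial>P z)"
  \<comment> \<open>By Fubini the quotient in question is the mean of \<open>c\<close> over
    \<open>{0..\<tau>}\<close>, so it converges to the right limit of \<open>c\<close> at 0. Weak
    right-continuity and the starting point \<open>z\<close> identify this limit as
    \<open>c 0 = L\<close>.\<close>
  define c where "c = (\<lambda>v. \<integral>\<omega>. f (Z v \<omega>) * \<Phi> \<omega> \<partial>P z)"
  have c: "c v = (\<integral>\<omega>. f (Z v \<omega>) * X \<omega> \<partial>P z)" if "0 \<le> v" for v
    unfolding c_def by (rule proj[of _ M]) (use that f_bounded in auto)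
  have c0: "c 0 = L"
  proof -
    have "c 0 = (\<integral>\<omega>. f z * \<Phi> \<omega> \<partial>P z)"
      unfolding c_def
      by (rule integral_cong_AE) (use start[of z] in \<open>auto simp: measurable_P_iff\<close>)
    then show ?thesis by (simp add: L_def)
  qed
  have "bounded (X ` space W)" using X_le by (intro boundedI[where B=C]) auto
  then have "((\<lambda>\<tau>. \<integral>\<omega>. f (Z (0 + \<tau>) \<omega>) * X \<omega> \<partial>P z) \<longlongrightarrow> (\<integral>\<omega>. f (Z 0 \<omega>) * X \<omega> \<partial>P z)) (at_right 0)"
    using rc X unfolding weakly_right_continuous_def A_def by blast
  then have lim: "((\<lambda>\<tau>. \<integral>\<omega>. f (Z \<tau> \<omega>) * X \<omega> \<partial>P z) \<longlongrightarrow> L) (at_right 0)"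
    using c[of 0] c0 by simp
  show ?thesis
    unfolding L_def[symmetric]
  proof (rule tendstoI)
    fix e :: real assume "0 < e"
    then have e2: "0 < e / 2" by simp
    from tendstoD[OF lim this] obtain d where d: "0 < d"
      and cd: "\<And>v. 0 < v \<Longrightarrow> v < d \<Longrightarrow> \<bar>(\<integral>\<omega>. f (Z v \<omega>) * X \<omega> \<partial>P z) - L\<bar> < e / 2"
      unfolding eventually_at_right_field dist_real_def by blast
    have cL: "\<bar>c v - L\<bar> \<le> e / 2" if "0 \<le> v" "v < d" for v
      using cd[of v] c[of v] c0 that e2 by (cases "v = 0") auto
    have "dist ((\<integral>\<omega>. additive 0 \<tau> \<omega> * \<Phi> \<omega> \<partial>P z) / \<tau>) L < e" if \<tau>: "0 < \<tau>" "\<tau> < d" for \<tau>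
    proof -
      note [measurable] = measurable_path_shift[OF order_refl sets_P[of z]]
      have \<Phi>z[measurable]: "\<Phi> \<in> borel_measurable (P z)" by (simp add: measurable_P_iff)
      have "(\<integral>\<omega>. additive 0 \<tau> \<omega> * \<Phi> \<omega> \<partial>P z)
          = (\<integral>\<omega>. (LINT v:{0..\<tau>}|lborel. f (Z (0 + max 0 v) \<omega>) * \<Phi> \<omega>) \<partial>P z)"
      proof (rule Bochner_Integration.integral_cong[OF refl])
        fix \<omega>
        have "additive 0 \<tau> \<omega> = (LINT v:{0..\<tau>}|lborel. f (Z (0 + max 0 v) \<omega>))"
          unfolding additive_def by (intro set_lebesgue_integral_cong) auto
        then show "additive 0 \<tau> \<omega> * \<Phi> \<omega> = (LINT v:{0..\<tau>}|lborel. f (Z (0 + max 0 v) \<omega>) * \<Phi> \<omega>)"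
          by simp
      qed
      also have "\<dots> = (LINT v:{0..\<tau>}|lborel. \<integral>\<omega>. f (Z (0 + max 0 v) \<omega>) * \<Phi> \<omega> \<partial>P z)"
      proof (rule set_integral_fubini_bounded[OF prob_space_P])
        show "\<bar>f (Z (0 + max 0 v) \<omega>) * \<Phi> \<omega>\<bar> \<le> M * C" if "\<omega> \<in> space (P z)" for v \<omega>
          unfolding abs_mult using f_bounded C that M_nonneg by (intro mult_mono) (auto simp: space_P)
      qed measurable
      also have "\<dots> = (LINT v:{0..\<tau>}|lborel. c (max 0 v))" by (simp add: c_def)
      finally have eq: "(\<integral>\<omega>. additive 0 \<tau> \<omega> * \<Phi> \<omega> \<partial>P z) = (LINT v:{0..\<tau>}|lborel. c (max 0 v))" .
      have "(\<lambda>v. c (max 0 v)) \<in> borel_measurable borel"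
      proof -
        have "(\<lambda>v. \<integral>\<omega>. f (Z (0 + max 0 v) \<omega>) * \<Phi> \<omega> \<partial>P z) \<in> borel_measurable borel"
          by (rule Pz.borel_measurable_lebesgue_integral) measurable
        then show ?thesis by (simp add: c_def)
      qed
      moreover have "\<bar>c v\<bar> \<le> M * C" for v
        unfolding c_def
        by (rule abs_integral_P_le) (unfold abs_mult, use f_bounded C M_nonneg in \<open>auto intro!: mult_mono\<close>)
      ultimately have int: "set_integrable lborel {0..\<tau>} (\<lambda>v. c (max 0 v))"
        unfolding set_integrable_def
        by (intro integrableI_bounded_set_indicator[where B="M * C"]) (auto simp: emeasure_lborel_Icc_eq)
      have "(LINT v:{0..\<tau>}|lborel. c (max 0 v) - L) = (LINT v:{0..\<tau>}|lborel. c (max 0 v)) - (LINT v:{0..\<tau>}|lborel. L)"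
        by (rule set_integral_diff(2)[OF int set_integrable_const_Icc])
      moreover have "(LINT v:{0..\<tau>}|lborel. L) = \<tau> * L"
        using \<tau> by (simp add: set_lebesgue_integral_def)
      moreover have "\<bar>LINT v:{0..\<tau>}|lborel. c (max 0 v) - L\<bar> \<le> e / 2 * (\<tau> - 0)"
        using \<tau> cL by (intro abs_set_integral_Icc_le) auto
      ultimately have "\<bar>(LINT v:{0..\<tau>}|lborel. c (max 0 v)) - \<tau> * L\<bar> \<le> e / 2 * \<tau>" by simp
      then have "\<bar>(LINT v:{0..\<tau>}|lborel. c (max 0 v)) - \<tau> * L\<bar> / \<tau> \<le> e / 2"
        using \<tau> by (simp add: field_simps)
      moreover have "(LINT v:{0..\<tau>}|lborel. c (max 0 v)) / \<tau> - L = ((LINT v:{0..\<tau>}|lborel. c (max 0 v)) - \<tau> * L) / \<tau>"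
        using \<tau> by (simp add: field_simps)
      ultimately have "\<bar>(LINT v:{0..\<tau>}|lborel. c (max 0 v)) / \<tau> - L\<bar> \<le> e / 2"
        using \<tau> by (simp add: abs_divide)
      then show ?thesis
        using e2 unfolding eq dist_real_def by linarith
    qed
    then show "\<forall>\<^sub>F \<tau> in at_right 0. dist ((\<integral>\<omega>. additive 0 \<tau> \<omega> * \<Phi> \<omega> \<partial>P z) / \<tau>) L < e"
      using d by (auto simp: eventually_at_right_field)
  qed
qed

lemma measurable_mgf [measurable]: "mgf \<theta> t \<in> borel_measurable borel"
  and measurable_resolvent [measurable]: "resolvent \<theta> t \<in> borel_measurable borel"
proof -
  have [measurable]: "additive 0 t \<in> borel_measurable W" "exp_integral \<theta> 0 t \<in> borel_measurable W" by auto
  show "mgf \<theta> t \<in> borel_measurable borel" unfolding mgf_def[abs_def] by measurable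
  show "resolvent \<theta> t \<in> borel_measurable borel" unfolding resolvent_def[abs_def] by measurable
qed

lemma integrable_exp_additive: "0 \<le> t \<Longrightarrow> integrable (P z) (\<lambda>\<omega>. exp (\<theta> * additive 0 t \<omega>))"
proof -
  assume t: "0 \<le> t"
  have [measurable]: "additive 0 t \<in> borel_measurable W" by simp
  show ?thesis
    using exp_additive_le[OF t order_refl] by (intro integrable_P[where C="exp (\<bar>\<theta>\<bar> * M * t)"]) auto
qed

lemma integrable_exp_integral: "0 \<le> \<tau> \<Longrightarrow> 0 \<le> t \<Longrightarrow> integrable (P z) (exp_integral \<theta> \<tau> t)"
  using exp_integral_bounds[of t] by (intro integrable_P[where C="exp (\<bar>\<theta>\<bar> * M * t) * t"]) auto

lemma abs_mgf_le: "0 \<le> t \<Longrightarrow> \<bar>mgf \<theta> t z\<bar> \<le> exp (\<bar>\<theta>\<bar> * M * t)"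
  unfolding mgf_def using exp_additive_le[of t t] by (intro abs_integral_P_le) auto

lemma abs_resolvent_le: "0 \<le> t \<Longrightarrow> \<bar>resolvent \<theta> t z\<bar> \<le> exp (\<bar>\<theta>\<bar> * M * t) * t"
  unfolding resolvent_def using exp_integral_bounds[of t] by (intro abs_integral_P_le) auto

lemma resolvent_nonneg: "0 \<le> t \<Longrightarrow> 0 \<le> resolvent \<theta> t z"
  unfolding resolvent_def using exp_integral_bounds(1)[of t] by (intro Bochner_Integration.integral_nonneg) auto

text \<open>The expectation of the pathwise estimate \<open>abs_exp_minus_1_le\<close>.\<close>

lemma abs_mgf_minus_1_le:
  assumes t: "0 \<le> t" shows "\<bar>mgf \<theta> t z - 1\<bar> \<le> \<bar>\<theta>\<bar> * M * resolvent \<theta> t z"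
proof -
  interpret Pz: prob_space "P z" by (rule prob_space_P)
  have meas[measurable]: "additive 0 t \<in> borel_measurable W" "exp_integral \<theta> 0 t \<in> borel_measurable W" by auto
  have int: "integrable (P z) (\<lambda>\<omega>. exp (\<theta> * additive 0 t \<omega>))" "integrable (P z) (exp_integral \<theta> 0 t)"
    using t by (auto intro: integrable_exp_additive integrable_exp_integral)
  have "\<bar>mgf \<theta> t z - 1\<bar> = \<bar>\<integral>\<omega>. exp (\<theta> * additive 0 t \<omega>) - 1 \<partial>P z\<bar>"
    using int by (simp add: mgf_def Pz.prob_space)
  also have "\<dots> \<le> (\<integral>\<omega>. \<bar>exp (\<theta> * additive 0 t \<omega>) - 1\<bar> \<partial>P z)" by simp
  also have "\<dots> \<le> (\<integral>\<omega>. \<bar>\<theta>\<bar> * M * exp_integral \<theta> 0 t \<omega> \<partial>P z)"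
  proof (rule integral_mono)
    fix \<omega> assume "\<omega> \<in> space (P z)"
    then interpret lipschitz_path "\<lambda>r. \<theta> * additive 0 r \<omega>" "\<bar>\<theta>\<bar> * M"
      by (intro lipschitz_path_additive) (simp add: space_P)
    show "\<bar>exp (\<theta> * additive 0 t \<omega>) - 1\<bar> \<le> \<bar>\<theta>\<bar> * M * exp_integral \<theta> 0 t \<omega>"
      unfolding exp_integral_def by (rule abs_exp_minus_1_le[OF t])
  qed (use int in auto)
  finally show ?thesis by (simp add: resolvent_def)
qed

text \<open>The constant of \<open>shifted_integral_expansion\<close> for
  \<open>k = \<bar>\<theta>\<bar> * M\<close>. It is the same for all starting points.\<close>

definition quotient_error :: "real \<Rightarrow> real \<Rightarrow> real" where
  "quotient_error \<theta> t = (let k = \<bar>\<theta>\<bar> * M; E = exp (k * (t + 1)) in E\<^sup>2 * k\<^sup>2 * t + 2 * k * E\<^sup>2 + 2 * k * E)"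

text \<open>The expectation of the pathwise expansion, divided by \<open>\<tau>\<close>. By
  \<open>additive_eq_diff\<close>, \<open>exp_integral \<theta> \<tau> t\<close> is the shifted
  integral treated there.\<close>

lemma quotient_expansion:
  assumes t: "0 \<le> t" and \<tau>: "0 < \<tau>" "\<tau> \<le> 1"
  shows "\<bar>(semigroup P Z \<tau> (resolvent \<theta> t) z - resolvent \<theta> t z) / \<tau>
    - (mgf \<theta> t z - 1 - \<theta> * ((\<integral>\<omega>. additive 0 \<tau> \<omega> * exp_integral \<theta> 0 t \<omega> \<partial>P z) / \<tau>))\<bar> \<le> quotient_error \<theta> t * \<tau>"
proof -
  interpret Pz: prob_space "P z" by (rule prob_space_P)
  have \<tau>0: "0 \<le> \<tau>" using \<tau> by simp
  have [measurable]: "additive 0 t \<in> borel_measurable W" "additive 0 \<tau> \<in> borel_measurable W"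
    "exp_integral \<theta> 0 t \<in> borel_measurable W" "exp_integral \<theta> \<tau> t \<in> borel_measurable W"
    using \<tau> by auto
  have int: "integrable (P z) (\<lambda>\<omega>. exp (\<theta> * additive 0 t \<omega>))" "integrable (P z) (exp_integral \<theta> 0 t)"
    "integrable (P z) (exp_integral \<theta> \<tau> t)"
    using t \<tau>0 by (auto intro: integrable_exp_additive integrable_exp_integral)
  have int2: "integrable (P z) (\<lambda>\<omega>. additive 0 \<tau> \<omega> * exp_integral \<theta> 0 t \<omega>)"
  proof (rule integrable_P)
    show "\<bar>additive 0 \<tau> \<omega> * exp_integral \<theta> 0 t \<omega>\<bar> \<le> (M * \<tau>) * (exp (\<bar>\<theta>\<bar> * M * t) * t)" for \<omega>
      unfolding abs_mult using exp_integral_bounds[OF t] M_nonneg \<tau>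
      by (intro mult_mono abs_additive_le) auto
  qed measurable
  define R where "R = (\<lambda>\<omega>. exp_integral \<theta> \<tau> t \<omega> - exp_integral \<theta> 0 t \<omega> - \<tau> * (exp (\<theta> * additive 0 t \<omega>) - 1)
      + \<theta> * (additive 0 \<tau> \<omega> * exp_integral \<theta> 0 t \<omega>))"
  have "\<bar>R \<omega>\<bar> \<le> quotient_error \<theta> t * \<tau>\<^sup>2" if \<omega>: "\<omega> \<in> space W" for \<omega>
  proof -
    interpret lipschitz_path "\<lambda>r. \<theta> * additive 0 r \<omega>" "\<bar>\<theta>\<bar> * M"
      using \<omega> by (rule lipschitz_path_additive)
    have "exp_integral \<theta> \<tau> t \<omega> = (LINT r:{0..t}|lborel. exp (\<theta> * additive 0 (\<tau> + r) \<omega> - \<theta> * additive 0 \<tau> \<omega>))"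
      unfolding exp_integral_def using \<omega> \<tau>
      by (intro set_lebesgue_integral_cong) (auto simp: additive_eq_diff[where \<tau>=\<tau>] right_diff_distrib)
    then show ?thesis
      using shifted_integral_expansion[OF t \<tau>0 \<tau>(2)]
      by (simp add: R_def quotient_error_def Let_def exp_integral_def[of \<theta> 0] mult.assoc)
  qed
  then have "\<bar>\<integral>\<omega>. R \<omega> \<partial>P z\<bar> \<le> quotient_error \<theta> t * \<tau>\<^sup>2" by (rule abs_integral_P_le)
  also have "(\<integral>\<omega>. R \<omega> \<partial>P z) = semigroup P Z \<tau> (resolvent \<theta> t) z - resolvent \<theta> t z - \<tau> * (mgf \<theta> t z - 1)
      + \<theta> * (\<integral>\<omega>. additive 0 \<tau> \<omega> * exp_integral \<theta> 0 t \<omega> \<partial>P z)"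
    using int int2 by (simp add: R_def semigroup_resolvent[OF \<tau>0 t] mgf_def resolvent_def Pz.prob_space)
  finally have le: "\<bar>\<dots>\<bar> \<le> quotient_error \<theta> t * \<tau>\<^sup>2" .
  have eq: "(a - b) / \<tau> - (m - 1 - \<theta> * (c / \<tau>)) = (a - b - \<tau> * (m - 1) + \<theta> * c) / \<tau>" for a b m c
    using \<tau> by (simp add: field_simps)
  show ?thesis
    unfolding eq abs_divide using le \<tau> by (simp add: field_simps power2_eq_square)
qed

text \<open>The remainder in \<open>quotient_expansion\<close> vanishes, and
  \<open>averaged_right_limit\<close> with \<open>exp_integral \<theta> 0 t\<close> as the factor
  evaluates the rest. The outcome is the time-integrated Feynman-Kac equation.\<close>

lemma generator_resolvent_limit:
  assumes rc: "weakly_right_continuous W P Z f" and t: "0 \<le> t"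
  shows "((\<lambda>\<tau>. (semigroup P Z \<tau> (resolvent \<theta> t) z - resolvent \<theta> t z) / \<tau>)
    \<longlongrightarrow> mgf \<theta> t z - 1 - \<theta> * (f z * resolvent \<theta> t z)) (at_right 0)"
proof -
  define main where "main = (\<lambda>\<tau>. mgf \<theta> t z - 1 - \<theta> * ((\<integral>\<omega>. additive 0 \<tau> \<omega> * exp_integral \<theta> 0 t \<omega> \<partial>P z) / \<tau>))"
  define q where "q = (\<lambda>\<tau>. (semigroup P Z \<tau> (resolvent \<theta> t) z - resolvent \<theta> t z) / \<tau>)"
  have main: "(main \<longlongrightarrow> mgf \<theta> t z - 1 - \<theta> * (f z * resolvent \<theta> t z)) (at_right 0)"
    unfolding main_def resolvent_def using exp_integral_bounds[OF t]
    by (intro tendsto_intros averaged_right_limit[OF rc, where C="exp (\<bar>\<theta>\<bar> * M * t) * t"]) auto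
  have "((\<lambda>\<tau>. q \<tau> - main \<tau>) \<longlongrightarrow> 0) (at_right 0)"
  proof (rule Lim_null_comparison)
    have "norm (q \<tau> - main \<tau>) \<le> quotient_error \<theta> t * \<tau>" if "0 < \<tau>" "\<tau> < 1" for \<tau>
      using quotient_expansion[OF t, of \<tau> \<theta> z] that by (simp add: q_def main_def)
    then show "\<forall>\<^sub>F \<tau> in at_right 0. norm (q \<tau> - main \<tau>) \<le> quotient_error \<theta> t * \<tau>"
      by (intro eventually_at_rightI[of 0 1]) auto
    show "((\<lambda>\<tau>. quotient_error \<theta> t * \<tau>) \<longlongrightarrow> 0) (at_right 0)"
      by (auto intro!: tendsto_eq_intros)
  qed
  from tendsto_add[OF this main] show ?thesis by (simp add: q_def)
qed

text \<open>A bound uniform in both \<open>\<tau>\<close> and \<open>z\<close>, to serve as the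
  dominating constant when the limit is integrated against the invariant distribution.\<close>

lemma quotient_bounded:
  assumes t: "0 \<le> t"
  obtains B where "\<And>\<tau> z. 0 < \<tau> \<Longrightarrow> \<tau> \<le> 1 \<Longrightarrow> \<bar>(semigroup P Z \<tau> (resolvent \<theta> t) z - resolvent \<theta> t z) / \<tau>\<bar> \<le> B"
proof
  define Y where "Y = exp (\<bar>\<theta>\<bar> * M * t) * t"
  have "0 \<le> Y" using t by (simp add: Y_def)
  fix \<tau> z assume \<tau>: "0 < \<tau>" "\<tau> \<le> (1::real)"
  have qe: "0 \<le> quotient_error \<theta> t" using t M_nonneg by (simp add: quotient_error_def Let_def)
  have "\<bar>\<integral>\<omega>. additive 0 \<tau> \<omega> * exp_integral \<theta> 0 t \<omega> \<partial>P z\<bar> \<le> (M * \<tau>) * Y"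
  proof (rule abs_integral_P_le)
    show "\<bar>additive 0 \<tau> \<omega> * exp_integral \<theta> 0 t \<omega>\<bar> \<le> (M * \<tau>) * Y" for \<omega>
      unfolding abs_mult Y_def using exp_integral_bounds[OF t] M_nonneg \<tau>
      by (intro mult_mono abs_additive_le) auto
  qed
  then have "\<bar>(\<integral>\<omega>. additive 0 \<tau> \<omega> * exp_integral \<theta> 0 t \<omega> \<partial>P z) / \<tau>\<bar> \<le> M * Y"
    using \<tau> by (simp add: field_simps)
  then have "\<bar>\<theta> * ((\<integral>\<omega>. additive 0 \<tau> \<omega> * exp_integral \<theta> 0 t \<omega> \<partial>P z) / \<tau>)\<bar> \<le> \<bar>\<theta>\<bar> * (M * Y)"
    unfolding abs_mult by (rule mult_left_mono) simp
  moreover have "quotient_error \<theta> t * \<tau> \<le> quotient_error \<theta> t" using qe \<tau> by (simp add: mult_left_le)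
  ultimately show "\<bar>(semigroup P Z \<tau> (resolvent \<theta> t) z - resolvent \<theta> t z) / \<tau>\<bar>
      \<le> exp (\<bar>\<theta>\<bar> * M * t) + 1 + \<bar>\<theta>\<bar> * (M * Y) + quotient_error \<theta> t"
    using quotient_expansion[OF t \<tau>, of \<theta> z] abs_mgf_le[OF t, of \<theta> z] by linarith
qed

end

subsection \<open>The moment generating function under the invariant distribution\<close>

text \<open>Cauchy-Schwarz with prescribed bounds for the second moments, from the weighted
  inequality between arithmetic and geometric means.\<close>

lemma (in prob_space) abs_expectation_mult_le:
  fixes f g :: "'a \<Rightarrow> real"
  assumes f: "integrable M (\<lambda>x. (f x)\<^sup>2)" "expectation (\<lambda>x. (f x)\<^sup>2) \<le> \<sigma>\<^sup>2" "0 < \<sigma>"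
    and g: "integrable M (\<lambda>x. (g x)\<^sup>2)" "expectation (\<lambda>x. (g x)\<^sup>2) \<le> s\<^sup>2" "0 \<le> s"
    and fg: "integrable M (\<lambda>x. f x * g x)"
  shows "\<bar>expectation (\<lambda>x. f x * g x)\<bar> \<le> \<sigma> * s"
proof (rule field_le_epsilon)
  fix e :: real assume e: "0 < e"
  \<comment> \<open>The weights divide by the bound for \<open>g\<close>, which may be 0; it is
    enlarged so that the final bound exceeds \<open>\<sigma> * s\<close> by exactly
    \<open>e\<close>.\<close>
  define s' where "s' = s + e / \<sigma>"
  have s': "0 < s'" "s\<^sup>2 \<le> s'\<^sup>2" using e f(3) g(3) by (auto simp: s'_def intro!: add_nonneg_pos power_mono)
  have "\<bar>expectation (\<lambda>x. f x * g x)\<bar> \<le> expectation (\<lambda>x. \<bar>f x * g x\<bar>)" by simp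
  also have "\<dots> \<le> expectation (\<lambda>x. (s' / \<sigma> * (f x)\<^sup>2 + \<sigma> / s' * (g x)\<^sup>2) / 2)"
  proof (rule integral_mono)
    fix x
    have "0 \<le> (s' * \<bar>f x\<bar> - \<sigma> * \<bar>g x\<bar>)\<^sup>2 / (\<sigma> * s')" using s' f(3) by simp
    also have "\<dots> = s' / \<sigma> * (f x)\<^sup>2 + \<sigma> / s' * (g x)\<^sup>2 - 2 * \<bar>f x * g x\<bar>"
      using s' f(3) by (simp add: power2_eq_square field_simps abs_mult)
    finally show "\<bar>f x * g x\<bar> \<le> (s' / \<sigma> * (f x)\<^sup>2 + \<sigma> / s' * (g x)\<^sup>2) / 2" by simp
  qed (use f g fg in auto)
  also have "\<dots> = (s' / \<sigma> * expectation (\<lambda>x. (f x)\<^sup>2) + \<sigma> / s' * expectation (\<lambda>x. (g x)\<^sup>2)) / 2"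
    using f g by simp
  also have "\<dots> \<le> (s' / \<sigma> * \<sigma>\<^sup>2 + \<sigma> / s' * s'\<^sup>2) / 2"
    using f(2,3) order_trans[OF g(2) s'(2)] s'(1) by (intro divide_right_mono add_mono mult_left_mono) simp_all
  also have "\<dots> = \<sigma> * s + e"
  proof -
    have "s' / \<sigma> * \<sigma>\<^sup>2 = \<sigma> * s'" "\<sigma> / s' * s'\<^sup>2 = \<sigma> * s'"
      using s'(1) f(3) by (simp_all add: power2_eq_square)
    moreover have "\<sigma> * s' = \<sigma> * s + e"
      using f(3) by (simp add: s'_def distrib_left)
    ultimately show ?thesis by simp
  qed
  finally show "\<bar>expectation (\<lambda>x. f x * g x)\<bar> \<le> \<sigma> * s + e" .
qed

text \<open>With \<open>A\<close> the primitive of \<open>a\<close>, the function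
  \<open>exp (- c * t) * (1 + c * A t)\<close> has derivative
  \<open>c * exp (- c * t) * (a t - (1 + c * A t))\<close>, which the hypothesis makes nonpositive.
  Its value at 0 is 1.\<close>

lemma gronwall_exp:
  fixes a :: "real \<Rightarrow> real"
  assumes T: "0 \<le> T" and c: "0 \<le> c" and cont: "continuous_on {0..T} a"
    and a: "\<And>t. t \<in> {0..T} \<Longrightarrow> a t \<le> 1 + c * (LINT r:{0..t}|lborel. a r)"
  shows "a T \<le> exp (c * T)"
proof -
  define A where "A = (\<lambda>t. integral {0..t} a)"
  have A: "(LINT r:{0..t}|lborel. a r) = A t" if "t \<in> {0..T}" for t
    unfolding A_def using that
    by (intro set_borel_integral_eq_integral borel_integrable_atLeastAtMost' continuous_on_subset[OF cont]) auto
  have contA: "continuous_on {0..T} A"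
    unfolding A_def by (intro indefinite_integral_continuous_1 integrable_continuous_real cont)
  have "exp (- c * T) * (1 + c * A T) \<le> exp (- c * 0) * (1 + c * A 0)"
  proof (cases "T = 0")
    case False
    show ?thesis
    proof (rule DERIV_nonpos_imp_decreasing_open[where f="\<lambda>t. exp (- c * t) * (1 + c * A t)"])
      fix t assume t: "0 < t" "t < T"
      have "(A has_vector_derivative a t) (at t within {0..T})"
        unfolding A_def using t by (intro integral_has_vector_derivative cont) auto
      then have [derivative_intros]: "(A has_real_derivative a t) (at t)"
        using t by (simp add: has_real_derivative_iff_has_vector_derivative at_within_Icc_at)
      have "((\<lambda>t. exp (- c * t) * (1 + c * A t)) has_real_derivative
          exp (- c * t) * c * (a t - (1 + c * A t))) (at t)"
        by (auto intro!: derivative_eq_intros simp: algebra_simps)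
      moreover have "exp (- c * t) * c * (a t - (1 + c * A t)) \<le> 0"
        using a[of t] A[of t] t c by (intro mult_nonneg_nonpos) auto
      ultimately show "\<exists>y. ((\<lambda>t. exp (- c * t) * (1 + c * A t)) has_real_derivative y) (at t) \<and> y \<le> 0"
        by blast
    qed (use T False contA in \<open>auto intro!: continuous_intros\<close>)
  qed simp
  also have "\<dots> = 1" by (simp add: A_def)
  finally have "1 + c * A T \<le> exp (c * T)"
    by (simp add: exp_minus field_simps)
  with a[of T] A[of T] T show ?thesis by simp
qed

text \<open>The variance bound is put as a bound on the second moment, the same thing by
  \<open>mean_zero\<close>.\<close>

locale stationary_functional = additive_functional W P Z f M
  for W :: "'w measure" and P :: "'a::polish_space \<Rightarrow> 'w measure" and Z :: "real \<Rightarrow> 'w \<Rightarrow> 'a" and f M +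
  fixes \<mu> :: "'a measure" and \<eta> \<sigma> :: real
  assumes invariant: "invariant_distribution P Z \<mu>"
    and gap: "iterated_poincare_gap P Z \<mu> \<eta>"
    and right_cont: "weakly_right_continuous W P Z f"
    and mean_zero: "(\<integral>z. f z \<partial>\<mu>) = 0"
    and variance_le: "(\<integral>z. (f z)\<^sup>2 \<partial>\<mu>) \<le> \<sigma>\<^sup>2"
    and \<sigma>_pos: "0 < \<sigma>"
begin

sublocale \<mu>: prob_space \<mu>
  using invariant by (simp add: invariant_distribution_def)

lemma sets_\<mu> [measurable_cong]: "sets \<mu> = sets borel"
  using invariant by (simp add: invariant_distribution_def)

lemma \<eta>_pos: "0 < \<eta>"
  using gap by (simp add: iterated_poincare_gap_def)

lemma integrable_\<mu>:
  assumes "g \<in> borel_measurable borel" "\<And>z. \<bar>g z\<bar> \<le> (C::real)" shows "integrable \<mu> g"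
  using assms by (intro \<mu>.integrable_const_bound[where B=C] AE_I2) auto

lemma kernel_\<mu>: "P \<in> \<mu> \<rightarrow>\<^sub>M prob_algebra W"
  using kernel by (simp add: measurable_cong_sets[OF sets_\<mu> refl])

abbreviation "stationary \<equiv> \<mu> \<bind> P"

lemma prob_space_stationary: "prob_space stationary"
  and sets_stationary: "sets stationary = sets W"
  by (auto intro!: prob_space_bind'[OF _ kernel_\<mu>] sets_bind'[OF _ kernel_\<mu>]
    simp: space_prob_algebra \<mu>.prob_space_axioms)

lemma space_stationary: "space stationary = space W"
  by (rule sets_eq_imp_space_eq[OF sets_stationary])

lemma integral_stationary:
  assumes "\<Phi> \<in> borel_measurable W" "\<And>\<omega>. \<omega> \<in> space W \<Longrightarrow> \<bar>\<Phi> \<omega>\<bar> \<le> (C::real)"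
  shows "(\<integral>\<omega>. \<Phi> \<omega> \<partial>stationary) = (\<integral>z. (\<integral>\<omega>. \<Phi> \<omega> \<partial>P z) \<partial>\<mu>)"
  by (rule integral_bind_bounded[OF \<mu>.prob_space_axioms kernel_\<mu> assms])

lemma stationary_mgf:
  assumes "0 \<le> t"
  shows "(\<integral>z. mgf \<theta> t z \<partial>\<mu>) = (\<integral>\<omega>. exp (\<theta> * additive 0 t \<omega>) \<partial>stationary)"
proof -
  have [measurable]: "additive 0 t \<in> borel_measurable W" by simp
  show ?thesis
    unfolding mgf_def using exp_additive_le[OF assms order_refl]
    by (intro integral_stationary[symmetric, where C="exp (\<bar>\<theta>\<bar> * M * t)"]) auto
qed

text \<open>Turns the mean of the resolvent into the integral that appears in Gronwall's
  inequality.\<close>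

lemma stationary_resolvent:
  assumes "0 \<le> t"
  shows "(\<integral>z. resolvent \<theta> t z \<partial>\<mu>) = (LINT r:{0..t}|lborel. \<integral>z. mgf \<theta> r z \<partial>\<mu>)"
proof -
  have "(\<integral>z. resolvent \<theta> t z \<partial>\<mu>) = (\<integral>\<omega>. exp_integral \<theta> 0 t \<omega> \<partial>stationary)"
    unfolding resolvent_def using exp_integral_bounds[OF assms]
    by (intro integral_stationary[symmetric, where C="exp (\<bar>\<theta>\<bar> * M * t) * t"]) auto
  also have "\<dots> = (LINT r:{0..t}|lborel. \<integral>\<omega>. exp (\<theta> * additive 0 r \<omega>) \<partial>stationary)"
    by (intro exp_integral_fubini prob_space_stationary sets_stationary order_refl)
  also have "\<dots> = (LINT r:{0..t}|lborel. \<integral>z. mgf \<theta> r z \<partial>\<mu>)"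
    by (intro set_lebesgue_integral_cong) (auto simp: stationary_mgf)
  finally show ?thesis .
qed

text \<open>The paths are Lipschitz with a common constant and the exponentials are uniformly
  bounded up to \<open>T\<close>, so the mean is Lipschitz. Gronwall's inequality requires this
  continuity.\<close>

lemma continuous_stationary_mgf: "continuous_on {0..T} (\<lambda>t. \<integral>z. mgf \<theta> t z \<partial>\<mu>)"
proof (rule lipschitz_on_continuous_on)
  define E where "E = exp (\<bar>\<theta>\<bar> * M * T)"
  interpret S: prob_space stationary by (rule prob_space_stationary)
  have int: "integrable stationary (\<lambda>\<omega>. exp (\<theta> * additive 0 t \<omega>))" if "0 \<le> t" for t
  proof -
    have [measurable]: "additive 0 t \<in> borel_measurable stationary"
      using measurable_additive[OF order_refl, of t] by (simp add: measurable_cong_sets[OF sets_stationary refl])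
    show ?thesis
      using exp_additive_le[OF that order_refl]
      by (intro S.integrable_const_bound[where B="exp (\<bar>\<theta>\<bar> * M * t)"] AE_I2) auto
  qed
  show "(E * (\<bar>\<theta>\<bar> * M))-lipschitz_on {0..T} (\<lambda>t. \<integral>z. mgf \<theta> t z \<partial>\<mu>)"
  proof (rule lipschitz_onI)
    show "0 \<le> E * (\<bar>\<theta>\<bar> * M)" using M_nonneg by (simp add: E_def)
    have *: "\<bar>(\<integral>z. mgf \<theta> y z \<partial>\<mu>) - (\<integral>z. mgf \<theta> x z \<partial>\<mu>)\<bar> \<le> E * (\<bar>\<theta>\<bar> * M) * (y - x)"
      if "0 \<le> x" "x \<le> y" "y \<le> T" for x y
    proof -
      have "(\<integral>z. mgf \<theta> y z \<partial>\<mu>) - (\<integral>z. mgf \<theta> x z \<partial>\<mu>)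
          = (\<integral>\<omega>. exp (\<theta> * additive 0 y \<omega>) - exp (\<theta> * additive 0 x \<omega>) \<partial>stationary)"
        using int that by (simp add: stationary_mgf)
      also have "\<bar>\<dots>\<bar> \<le> E * (\<bar>\<theta>\<bar> * M) * (y - x)"
      proof (rule abs_integral_le_prob[OF prob_space_stationary])
        fix \<omega> assume "\<omega> \<in> space stationary"
        then interpret lipschitz_path "\<lambda>r. \<theta> * additive 0 r \<omega>" "\<bar>\<theta>\<bar> * M"
          by (intro lipschitz_path_additive) (simp add: space_stationary)
        have "\<bar>\<theta>\<bar> * M * x \<le> \<bar>\<theta>\<bar> * M * T" "\<bar>\<theta>\<bar> * M * y \<le> \<bar>\<theta>\<bar> * M * T"
          using that k_nonneg by (auto intro!: mult_left_mono)
        then have "\<bar>exp (\<theta> * additive 0 y \<omega>) - exp (\<theta> * additive 0 x \<omega>)\<bar> \<le> E * \<bar>\<theta> * additive 0 y \<omega> - \<theta> * additive 0 x \<omega>\<bar>"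
          unfolding E_def using abs_path_le[of x] abs_path_le[of y] that by (intro abs_exp_diff_le) auto
        also have "\<dots> \<le> E * (\<bar>\<theta>\<bar> * M * (y - x))"
          using lipschitz[of x y] that by (intro mult_left_mono) (auto simp: E_def)
        finally show "\<bar>exp (\<theta> * additive 0 y \<omega>) - exp (\<theta> * additive 0 x \<omega>)\<bar> \<le> E * (\<bar>\<theta>\<bar> * M) * (y - x)"
          by (simp add: mult.assoc)
      qed
      finally show ?thesis .
    qed
    fix x y assume "x \<in> {0..T}" "y \<in> {0..T}"
    then show "dist (\<integral>z. mgf \<theta> x z \<partial>\<mu>) (\<integral>z. mgf \<theta> y z \<partial>\<mu>) \<le> E * (\<bar>\<theta>\<bar> * M) * dist x y"
      using *[of x y] *[of y x] by (cases "x \<le> y") (auto simp: dist_real_def abs_minus_commute)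
  qed
qed

lemma generator_resolvent:
  assumes "0 \<le> t"
  shows "generator P Z (resolvent \<theta> t) z = mgf \<theta> t z - 1 - \<theta> * (f z * resolvent \<theta> t z)"
  unfolding generator_def
  by (rule tendsto_Lim[OF _ generator_resolvent_limit[OF right_cont assms]]) simp

lemma generator_defined_resolvent:
  assumes t: "0 \<le> t" shows "generator_defined P Z (resolvent \<theta> t)"
proof -
  have "integrable (P z) (\<lambda>\<omega>. resolvent \<theta> t (Z \<tau> \<omega>))" if "0 < \<tau>" for z \<tau>
  proof (rule integrable_P)
    show "(\<lambda>\<omega>. resolvent \<theta> t (Z \<tau> \<omega>)) \<in> borel_measurable W"
      using process_measurable[of \<tau>] that by (intro measurable_compose[OF _ measurable_resolvent]) auto
  qed (rule abs_resolvent_le[OF t])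
  then have "\<forall>\<^sub>F \<tau> in at_right 0. integrable (P z) (\<lambda>\<omega>. resolvent \<theta> t (Z \<tau> \<omega>))" for z
    by (intro eventually_at_rightI[of 0 1]) auto
  then show ?thesis
    unfolding generator_defined_def using generator_resolvent_limit[OF right_cont t] by blast
qed

text \<open>This says that the generator of the resolvent has mean zero under the invariant distribution.\<close>

lemma stationary_mgf_eq:
  assumes t: "0 \<le> t"
  shows "(\<integral>z. mgf \<theta> t z \<partial>\<mu>) = 1 + \<theta> * (\<integral>z. f z * resolvent \<theta> t z \<partial>\<mu>)"
proof -
  let ?H = "resolvent \<theta> t" and ?C = "exp (\<bar>\<theta>\<bar> * M * t) * t"
  obtain B where B: "\<And>\<tau> z. 0 < \<tau> \<Longrightarrow> \<tau> \<le> 1 \<Longrightarrow> \<bar>(semigroup P Z \<tau> ?H z - ?H z) / \<tau>\<bar> \<le> B"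
    using quotient_bounded[OF t] by blast
  \<comment> \<open>Dominated convergence works along sequences, so the right limit at 0 is sampled
    at \<open>1 / (n + 1)\<close>, which stays within the range of the bound
    \<open>B\<close>.\<close>
  define X where "X = (\<lambda>n. inverse (real (Suc n)))"
  have X: "0 < X n" "X n \<le> 1" for n by (auto simp: X_def field_simps)
  have limX: "filterlim X (at_right 0) sequentially"
    using LIMSEQ_inverse_real_of_nat X unfolding X_def by (intro tendsto_imp_filterlim_at_right) auto
  have [measurable]: "semigroup P Z (X n) ?H \<in> borel_measurable borel" for n
    using X[of n] by (intro measurable_semigroup) auto
  have int: "integrable \<mu> ?H" "integrable \<mu> (semigroup P Z (X n) ?H)" for n
    using abs_resolvent_le[OF t] abs_semigroup_le[OF abs_resolvent_le[OF t]] by (auto intro!: integrable_\<mu>)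
  have "(\<lambda>n. \<integral>z. (semigroup P Z (X n) ?H z - ?H z) / X n \<partial>\<mu>)
      \<longlonglongrightarrow> (\<integral>z. mgf \<theta> t z - 1 - \<theta> * (f z * ?H z) \<partial>\<mu>)"
  proof (rule integral_dominated_convergence[where w="\<lambda>_. B"])
    show "AE z in \<mu>. (\<lambda>n. (semigroup P Z (X n) ?H z - ?H z) / X n) \<longlonglongrightarrow> mgf \<theta> t z - 1 - \<theta> * (f z * ?H z)"
      using filterlim_compose[OF generator_resolvent_limit[OF right_cont t] limX] by simp
    show "AE z in \<mu>. norm ((semigroup P Z (X n) ?H z - ?H z) / X n) \<le> B" for n
      unfolding real_norm_def by (intro AE_I2 B X)
  qed auto
  moreover have "(\<integral>z. (semigroup P Z (X n) ?H z - ?H z) / X n \<partial>\<mu>) = 0" for n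
  proof -
    have "bounded (range ?H)" using abs_resolvent_le[OF t] by (intro boundedI) auto
    then have "(\<integral>z. semigroup P Z (X n) ?H z \<partial>\<mu>) = (\<integral>z. ?H z \<partial>\<mu>)"
      using invariant X[of n] by (simp add: invariant_distribution_def)
    then show ?thesis using int by simp
  qed
  ultimately have "(\<lambda>n::nat. 0) \<longlonglongrightarrow> (\<integral>z. mgf \<theta> t z - 1 - \<theta> * (f z * ?H z) \<partial>\<mu>)"
    by (simp only:)
  then have "(\<integral>z. mgf \<theta> t z - 1 - \<theta> * (f z * ?H z) \<partial>\<mu>) = 0"
    by (simp add: LIMSEQ_const_iff)
  moreover have "integrable \<mu> (\<lambda>z. f z * ?H z)"
  proof (rule integrable_\<mu>)
    show "\<bar>f z * ?H z\<bar> \<le> M * ?C" for z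
      unfolding abs_mult using f_bounded abs_resolvent_le[OF t] M_nonneg by (intro mult_mono) auto
  qed measurable
  moreover have "integrable \<mu> (mgf \<theta> t)"
    using abs_mgf_le[OF t] by (intro integrable_\<mu>) auto
  ultimately show ?thesis by (simp add: \<mu>.prob_space)
qed

text \<open>The gap and the pointwise bound \<open>G\<close> give a variance of at most
  \<open>\<beta>\<^sup>2\<close> times the second moment, that is, \<open>\<beta>\<^sup>2\<close>
  times the variance plus the squared mean. As \<open>\<beta> < 1\<close>, the variance can be
  absorbed on the left.\<close>

lemma variance_resolvent_le:
  assumes t: "0 \<le> t" and \<beta>: "\<beta> = 2 * (\<bar>\<theta>\<bar> * M) / \<eta>" "\<beta> < 1"
  shows "\<mu>.variance (resolvent \<theta> t) \<le> (\<beta> / sqrt (1 - \<beta>\<^sup>2) * (\<integral>z. resolvent \<theta> t z \<partial>\<mu>))\<^sup>2"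
proof -
  let ?H = "resolvent \<theta> t" and ?C = "exp (\<bar>\<theta>\<bar> * M * t) * t" and ?k = "\<bar>\<theta>\<bar> * M"
  have k: "0 \<le> ?k" using M_nonneg by simp
  have \<beta>0: "0 \<le> \<beta>" using k \<eta>_pos by (simp add: \<beta>)
  have \<beta>1: "0 < 1 - \<beta>\<^sup>2" using \<beta>0 \<beta>(2) by (simp add: power_less_one_iff)
  have H2: "integrable \<mu> (\<lambda>z. (?H z)\<^sup>2)"
  proof (rule integrable_\<mu>)
    show "\<bar>(?H z)\<^sup>2\<bar> \<le> ?C\<^sup>2" for z
      using power_mono[OF abs_resolvent_le[OF t, of \<theta> z], of 2] by simp
  qed measurable
  have H1: "integrable \<mu> ?H" using abs_resolvent_le[OF t] by (intro integrable_\<mu>) auto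
  \<comment> \<open>Both parts of the generator, \<open>mgf \<theta> t z - 1\<close> and
    \<open>\<theta> * (f z * ?H z)\<close>, are at most \<open>?k * ?H z\<close> in absolute value;
    the resolvent is nonnegative.\<close>
  have G: "(generator P Z ?H z)\<^sup>2 \<le> (2 * ?k)\<^sup>2 * (?H z)\<^sup>2" for z
  proof -
    have "\<bar>\<theta> * (f z * ?H z)\<bar> \<le> ?k * ?H z"
      unfolding abs_mult using f_bounded resolvent_nonneg[OF t, of \<theta> z]
      by (simp add: mult.assoc mult_left_mono mult_right_mono)
    then have "\<bar>generator P Z ?H z\<bar> \<le> 2 * ?k * ?H z"
      unfolding generator_resolvent[OF t] using abs_mgf_minus_1_le[OF t, of \<theta> z] by linarith
    then have "\<bar>generator P Z ?H z\<bar>\<^sup>2 \<le> (2 * ?k * ?H z)\<^sup>2" by (rule power_mono) simp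
    then show ?thesis by (simp add: power_mult_distrib)
  qed
  have "?H \<in> L2 \<mu>" using H2 by (simp add: L2_def)
  then have "ennreal (\<mu>.variance ?H) \<le> ennreal (1 / \<eta>\<^sup>2) * (\<integral>\<^sup>+z. ennreal ((generator P Z ?H z)\<^sup>2) \<partial>\<mu>)"
    using gap generator_defined_resolvent[OF t] by (simp add: iterated_poincare_gap_def)
  also have "\<dots> \<le> ennreal (1 / \<eta>\<^sup>2) * (\<integral>\<^sup>+z. ennreal ((2 * ?k)\<^sup>2 * (?H z)\<^sup>2) \<partial>\<mu>)"
    using G by (intro mult_left_mono nn_integral_mono ennreal_leI) auto
  also have "\<dots> = ennreal (1 / \<eta>\<^sup>2 * ((2 * ?k)\<^sup>2 * (\<integral>z. (?H z)\<^sup>2 \<partial>\<mu>)))"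
    using H2 by (subst nn_integral_eq_integral) (auto simp flip: ennreal_mult)
  also have "1 / \<eta>\<^sup>2 * ((2 * ?k)\<^sup>2 * (\<integral>z. (?H z)\<^sup>2 \<partial>\<mu>)) = \<beta>\<^sup>2 * (\<integral>z. (?H z)\<^sup>2 \<partial>\<mu>)"
    by (simp add: \<beta> power_divide)
  finally have "\<mu>.variance ?H \<le> \<beta>\<^sup>2 * (\<integral>z. (?H z)\<^sup>2 \<partial>\<mu>)"
    by (subst (asm) ennreal_le_iff) auto
  also have "(\<integral>z. (?H z)\<^sup>2 \<partial>\<mu>) = \<mu>.variance ?H + (\<integral>z. ?H z \<partial>\<mu>)\<^sup>2"
    using \<mu>.variance_eq[OF H1 H2] by simp
  finally have "\<mu>.variance ?H * (1 - \<beta>\<^sup>2) \<le> \<beta>\<^sup>2 * (\<integral>z. ?H z \<partial>\<mu>)\<^sup>2"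
    by (simp add: algebra_simps)
  then have "\<mu>.variance ?H \<le> \<beta>\<^sup>2 * (\<integral>z. ?H z \<partial>\<mu>)\<^sup>2 / (1 - \<beta>\<^sup>2)"
    using \<beta>1 by (simp add: pos_le_divide_eq)
  then show ?thesis using \<beta>1 by (simp add: power_mult_distrib power_divide)
qed

theorem stationary_mgf_le:
  assumes T: "0 \<le> T" and \<beta>: "\<beta> = 2 * (\<bar>\<theta>\<bar> * M) / \<eta>" "\<beta> < 1"
  shows "(\<integral>\<omega>. exp (\<theta> * additive 0 T \<omega>) \<partial>stationary) \<le> exp (\<bar>\<theta>\<bar> * \<sigma> * (\<beta> / sqrt (1 - \<beta>\<^sup>2)) * T)"
proof -
  have \<beta>0: "0 \<le> \<beta>" using M_nonneg \<eta>_pos by (simp add: \<beta>)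
  define K where "K = \<beta> / sqrt (1 - \<beta>\<^sup>2)"
  have K: "0 \<le> K" using \<beta>0 \<beta>(2) by (simp add: K_def power_le_one)
  have "(\<integral>z. mgf \<theta> t z \<partial>\<mu>) \<le> 1 + (\<bar>\<theta>\<bar> * \<sigma> * K) * (LINT r:{0..t}|lborel. \<integral>z. mgf \<theta> r z \<partial>\<mu>)" if t: "0 \<le> t" for t
  proof -
    let ?H = "resolvent \<theta> t" and ?C = "exp (\<bar>\<theta>\<bar> * M * t) * t"
    define A where "A = (\<integral>z. ?H z \<partial>\<mu>)"
    have A0: "0 \<le> A" unfolding A_def using resolvent_nonneg[OF t] by (intro Bochner_Integration.integral_nonneg) auto
    have bd: "\<bar>?H z - A\<bar> \<le> ?C + A" for z using abs_resolvent_le[OF t, of \<theta> z] A0 by linarith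
    have int: "integrable \<mu> f" "integrable \<mu> (\<lambda>z. f z * ?H z)"
      "integrable \<mu> (\<lambda>z. (f z)\<^sup>2)" "integrable \<mu> (\<lambda>z. (?H z - A)\<^sup>2)" "integrable \<mu> (\<lambda>z. f z * (?H z - A))"
    proof -
      show "integrable \<mu> f" using f_bounded by (intro integrable_\<mu>) auto
      show "integrable \<mu> (\<lambda>z. f z * ?H z)"
        by (rule integrable_\<mu>[where C="M * ?C"], measurable, unfold abs_mult)
           (use f_bounded abs_resolvent_le[OF t] M_nonneg in \<open>auto intro!: mult_mono\<close>)
      show "integrable \<mu> (\<lambda>z. (f z)\<^sup>2)"
        by (rule integrable_\<mu>[where C="M\<^sup>2"], measurable)
           (use power_mono[OF f_bounded, where n=2] in auto)
      show "integrable \<mu> (\<lambda>z. (?H z - A)\<^sup>2)"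
        by (rule integrable_\<mu>[where C="(?C + A)\<^sup>2"], measurable)
           (use power_mono[OF bd, where n=2] in auto)
      show "integrable \<mu> (\<lambda>z. f z * (?H z - A))"
        by (rule integrable_\<mu>[where C="M * (?C + A)"], measurable, unfold abs_mult)
           (use f_bounded bd M_nonneg in \<open>auto intro!: mult_mono\<close>)
    qed
    \<comment> \<open>Since \<open>f\<close> has mean zero, centring the resolvent does not change
      the integral, and Cauchy-Schwarz then sees only its variance.\<close>
    have "(\<integral>z. f z * (?H z - A) \<partial>\<mu>) = (\<integral>z. f z * ?H z \<partial>\<mu>)"
      using int by (simp add: right_diff_distrib mean_zero)
    moreover have "\<bar>\<integral>z. f z * (?H z - A) \<partial>\<mu>\<bar> \<le> \<sigma> * (K * A)"
      using variance_resolvent_le[OF t \<beta>] mult_nonneg_nonneg[OF K A0]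
      by (intro \<mu>.abs_expectation_mult_le int variance_le \<sigma>_pos) (auto simp: A_def K_def)
    ultimately have "\<bar>\<theta> * (\<integral>z. f z * ?H z \<partial>\<mu>)\<bar> \<le> \<bar>\<theta>\<bar> * (\<sigma> * (K * A))"
      by (simp add: abs_mult mult_left_mono)
    then show ?thesis
      using stationary_mgf_eq[OF t, of \<theta>] by (simp add: A_def stationary_resolvent[OF t] mult.assoc)
  qed
  then have "(\<integral>z. mgf \<theta> T z \<partial>\<mu>) \<le> exp ((\<bar>\<theta>\<bar> * \<sigma> * K) * T)"
    using K \<sigma>_pos by (intro gronwall_exp T continuous_stationary_mgf) auto
  then show ?thesis by (simp add: stationary_mgf[OF T] K_def)
qed

end

subsection \<open>Tail bounds\<close>

context stationary_functional
begin

text \<open>Chernoff's bound; the sign \<open>s\<close> selects the upper or the lower tail. For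
  \<open>\<delta> = 0\<close> the bound is 1 and hence trivial.\<close>

lemma stationary_one_sided_tail:
  assumes M: "0 < M" and t: "0 < t" and \<delta>: "0 \<le> \<delta>" and s: "\<bar>s\<bar> = 1"
  shows "measure stationary {\<omega> \<in> space W. \<delta> * t \<le> s * additive 0 t \<omega>}
    \<le> exp (- (t * \<eta> * \<delta>\<^sup>2 / (4 * M * sqrt (4 * \<sigma>\<^sup>2 + \<delta>\<^sup>2))))"
proof (cases "\<delta> = 0")
  interpret S: prob_space stationary by (rule prob_space_stationary)
  case True
  then show ?thesis by simp
next
  interpret S: prob_space stationary by (rule prob_space_stationary)
  case False
  with \<delta> have \<delta>: "0 < \<delta>" by simp
  define R where "R = sqrt (4 * \<sigma>\<^sup>2 + \<delta>\<^sup>2)"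
  \<comment> \<open>This choice makes \<open>\<beta> = 2 * \<theta> * M / \<eta>\<close> equal to
    \<open>\<delta> / R\<close>, hence \<open>\<beta> / sqrt (1 - \<beta>\<^sup>2)\<close> equal to
    \<open>\<delta> / (2 * \<sigma>)\<close>. The growth exponent of the moment generating function
    is then \<open>\<theta> * \<delta> * t / 2\<close>, half of the Chernoff gain
    \<open>\<theta> * \<delta> * t\<close>.\<close>
  define \<theta> where "\<theta> = \<delta> * \<eta> / (2 * M * R)"
  define \<beta> where "\<beta> = \<delta> / R"
  have R2: "R\<^sup>2 = 4 * \<sigma>\<^sup>2 + \<delta>\<^sup>2" by (simp add: R_def)
  have "sqrt (\<delta>\<^sup>2) < R" unfolding R_def using \<sigma>_pos by (intro real_sqrt_less_mono) simp
  then have R: "\<delta> < R" using \<delta> by simp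
  then have R0: "0 < R" using \<delta> by simp
  have \<theta>: "0 < \<theta>" using \<delta> \<eta>_pos M R0 by (simp add: \<theta>_def)
  have \<beta>: "\<beta> = 2 * (\<bar>s * \<theta>\<bar> * M) / \<eta>" "\<beta> < 1"
    using s \<theta> M \<eta>_pos R R0 by (simp_all add: \<beta>_def abs_mult) (simp add: \<theta>_def)
  have "1 - \<beta>\<^sup>2 = (R\<^sup>2 - \<delta>\<^sup>2) / R\<^sup>2"
    using R0 by (simp add: \<beta>_def power_divide diff_divide_distrib)
  also have "\<dots> = (2 * \<sigma> / R)\<^sup>2"
    using R2 by (simp add: power_divide power_mult_distrib)
  finally have "1 - \<beta>\<^sup>2 = (2 * \<sigma> / R)\<^sup>2" .
  then have "sqrt (1 - \<beta>\<^sup>2) = 2 * \<sigma> / R" using \<sigma>_pos R0 by simp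
  then have K: "\<beta> / sqrt (1 - \<beta>\<^sup>2) = \<delta> / (2 * \<sigma>)" using R0 by (simp add: \<beta>_def)
  define A where "A = {\<omega> \<in> space W. \<delta> * t \<le> s * additive 0 t \<omega>}"
  have add_meas: "additive 0 t \<in> borel_measurable W" by simp
  have [measurable]: "additive 0 t \<in> borel_measurable stationary"
    using add_meas by (simp add: measurable_cong_sets[OF sets_stationary refl])
  have A[measurable]: "A \<in> sets stationary"
    unfolding A_def using add_meas by (simp add: sets_stationary)
  have int: "integrable stationary (\<lambda>\<omega>. exp (s * \<theta> * additive 0 t \<omega>))"
    using exp_additive_le[of t t "s * \<theta>" 0] t
    by (intro S.integrable_const_bound[where B="exp (\<bar>s * \<theta>\<bar> * M * t)"] AE_I2) auto
  have "measure stationary A = (\<integral>\<omega>. indicator A \<omega> \<partial>stationary)"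
    using A by (simp add: A_def Int_absorb1 space_stationary)
  also have "\<dots> \<le> (\<integral>\<omega>. exp (- (\<theta> * \<delta> * t)) * exp (s * \<theta> * additive 0 t \<omega>) \<partial>stationary)"
  proof (rule integral_mono)
    fix \<omega>
    have "1 \<le> exp (- (\<theta> * \<delta> * t)) * exp (s * \<theta> * additive 0 t \<omega>)" if "\<delta> * t \<le> s * additive 0 t \<omega>"
    proof -
      have "\<theta> * (\<delta> * t) \<le> \<theta> * (s * additive 0 t \<omega>)" using that \<theta> by simp
      then show ?thesis by (simp add: mult_exp_exp algebra_simps)
    qed
    then show "indicator A \<omega> \<le> exp (- (\<theta> * \<delta> * t)) * exp (s * \<theta> * additive 0 t \<omega>)"
      by (simp add: A_def indicator_def)
  qed (use int A in \<open>auto simp: less_top[symmetric]\<close>)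
  also have "\<dots> \<le> exp (- (\<theta> * \<delta> * t)) * exp (\<bar>s * \<theta>\<bar> * \<sigma> * (\<delta> / (2 * \<sigma>)) * t)"
    using stationary_mgf_le[of t, OF _ \<beta>] t by (simp add: K)
  also have "\<dots> = exp (- (\<theta> * \<delta> * t) / 2)"
    using s \<theta> \<sigma>_pos by (simp add: mult_exp_exp abs_mult)
  also have "- (\<theta> * \<delta> * t) / 2 = - (t * \<eta> * \<delta>\<^sup>2 / (4 * M * R))"
    by (simp add: \<theta>_def power2_eq_square mult_ac)
  finally show ?thesis by (simp add: A_def R_def)
qed

lemma stationary_tail:
  assumes M: "0 < M" and t: "0 < t" and \<delta>: "0 \<le> \<delta>"
  shows "measure stationary {\<omega> \<in> space W. \<delta> \<le> \<bar>1 / t * additive 0 t \<omega>\<bar>}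
    \<le> 2 * exp (- (t * \<eta> * \<delta>\<^sup>2 / (4 * M * sqrt (4 * \<sigma>\<^sup>2 + \<delta>\<^sup>2))))"
proof -
  interpret S: prob_space stationary by (rule prob_space_stationary)
  define A where "A = (\<lambda>s. {\<omega> \<in> space W. \<delta> * t \<le> s * additive 0 t \<omega>})"
  have add_meas: "additive 0 t \<in> borel_measurable W" by simp
  then have A: "A s \<in> sets stationary" for s unfolding A_def by (simp add: sets_stationary)
  have "{\<omega> \<in> space W. \<delta> \<le> \<bar>1 / t * additive 0 t \<omega>\<bar>} \<subseteq> A 1 \<union> A (- 1)"
    using t by (auto simp: A_def abs_divide field_simps abs_if split: if_splits)
  then have "measure stationary {\<omega> \<in> space W. \<delta> \<le> \<bar>1 / t * additive 0 t \<omega>\<bar>} \<le> measure stationary (A 1 \<union> A (- 1))"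
    using A by (intro S.finite_measure_mono) auto
  also have "\<dots> \<le> measure stationary (A 1) + measure stationary (A (- 1))"
    using A by (intro measure_Un_le) auto
  also have "\<dots> \<le> 2 * exp (- (t * \<eta> * \<delta>\<^sup>2 / (4 * M * sqrt (4 * \<sigma>\<^sup>2 + \<delta>\<^sup>2))))"
    using stationary_one_sided_tail[OF M t \<delta>, of 1] stationary_one_sided_tail[OF M t \<delta>, of "- 1"]
    unfolding A_def by simp
  finally show ?thesis .
qed

end

section \<open>Change of the initial distribution\<close>

text \<open>Hoelder's inequality through Young's inequality for normalised factors. Since
  \<open>0 \<le> h \<le> 1\<close>, the power \<open>h powr r'\<close> is at most \<open>h\<close>,
  so the bound \<open>b\<close> on the mean of \<open>h\<close> suffices.\<close>

lemma Holder_powr_le: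
  fixes g h :: "'a \<Rightarrow> real"
  assumes \<mu>: "prob_space \<mu>" and r: "1 < r" "1 / r + 1 / r' = 1"
    and g: "g \<in> borel_measurable \<mu>" "\<And>x. 0 \<le> g x" "integrable \<mu> (\<lambda>x. g x powr r)"
    and h: "h \<in> borel_measurable \<mu>" "\<And>x. 0 \<le> h x" "\<And>x. h x \<le> 1"
    and b: "(\<integral>x. h x \<partial>\<mu>) \<le> b" "0 < b"
  shows "(\<integral>x. g x * h x \<partial>\<mu>) \<le> (\<integral>x. g x powr r \<partial>\<mu>) powr (1 / r) * b powr (1 / r')"
proof -
  interpret prob_space \<mu> by fact
  define I where "I = (\<integral>x. g x powr r \<partial>\<mu>)"
  have I0: "0 \<le> I" unfolding I_def by (intro Bochner_Integration.integral_nonneg) auto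
  have r': "1 < r'"
  proof -
    have "0 < 1 / r" "1 / r < 1" using r(1) by auto
    then have "0 < 1 / r'" "1 / r' < 1" using r(2) by linarith+
    then show ?thesis by (auto simp: field_simps zero_less_mult_iff split: if_splits)
  qed
  have inth: "integrable \<mu> h" using h by (intro integrable_const_bound[where B=1] AE_I2) auto
  show ?thesis
  \<comment> \<open>If \<open>I = 0\<close>, the normalising constant \<open>c\<close> would vanish;
    then \<open>g\<close> is zero almost everywhere and the left side is 0.\<close>
  proof (cases "I = 0")
    case True
    then have "AE x in \<mu>. g x powr r = 0"
      using integral_nonneg_eq_0_iff_AE[OF g(3)] by (simp add: I_def)
    then have "AE x in \<mu>. g x * h x = 0" by eventually_elim (simp add: powr_def split: if_splits)
    then have "(\<integral>x. g x * h x \<partial>\<mu>) = (\<integral>x. 0 \<partial>\<mu>)" using g h by (intro integral_cong_AE) auto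
    then show ?thesis by simp
  next
    case False
    with I0 have I: "0 < I" by simp
    define c where "c = I powr (1 / r)"
    define d where "d = b powr (1 / r')"
    have cd: "0 < c" "0 < d" using I b by (auto simp: c_def d_def)
    have cr: "c powr r = I" "d powr r' = b" using I b r(1) r' by (auto simp: c_def d_def powr_powr)
    have le: "g x * h x \<le> c * d * (g x powr r / I / r + h x / b / r')" for x
    proof -
      have "(g x / c) * (h x / d) \<le> (g x / c) powr r / r + (h x / d) powr r' / r'"
        using r r' g(2) h(2) cd by (intro Youngs_inequality) auto
      also have "(g x / c) powr r = g x powr r / I" using g(2) cd by (simp add: powr_divide cr)
      also have "(h x / d) powr r' = h x powr r' / b" using h(2) cd by (simp add: powr_divide cr)
      also have "h x powr r' \<le> h x"
        using powr_mono'[of 1 r' "h x"] r' h by simp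
      finally have "(g x / c) * (h x / d) \<le> g x powr r / I / r + h x / b / r'"
        using b r' by (simp add: divide_right_mono)
      then have "c * d * ((g x / c) * (h x / d)) \<le> c * d * (g x powr r / I / r + h x / b / r')"
        using cd by (intro mult_left_mono) auto
      then show ?thesis using cd by simp
    qed
    have int: "integrable \<mu> (\<lambda>x. c * d * (g x powr r / I / r + h x / b / r'))"
      using g(3) inth by auto
    have "integrable \<mu> (\<lambda>x. g x * h x)"
      using le g h cd by (intro Bochner_Integration.integrable_bound[OF int]) (auto intro!: AE_I2 order_trans[OF le abs_ge_self] simp del: times_divide_eq_left divide_divide_eq_left)
    then have "(\<integral>x. g x * h x \<partial>\<mu>) \<le> (\<integral>x. c * d * (g x powr r / I / r + h x / b / r') \<partial>\<mu>)"
      by (intro integral_mono int le)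
    also have "\<dots> = c * d * (I / I / r + (\<integral>x. h x \<partial>\<mu>) / b / r')"
      using g(3) inth by (simp add: I_def)
    also have "\<dots> \<le> c * d * (1 / r + 1 / r')"
      using cd I b r(1) r' by (intro mult_left_mono add_mono divide_right_mono) auto
    finally show ?thesis by (simp add: r c_def d_def I_def)
  qed
qed

text \<open>The integral over \<open>\<nu>\<close> becomes one over \<open>\<mu>\<close> of the
  density times \<open>h\<close>. For \<open>p = \<infinity>\<close> the density is bounded by its
  essential supremum, for \<open>p = 1\<close> its norm is 1 and the trivial bound 1 is enough, and
  in between Hoelder's inequality applies.\<close>

lemma integral_le_Lp_norm_density:
  fixes h :: "'a \<Rightarrow> real"
  assumes \<mu>: "prob_space \<mu>" and \<nu>: "prob_space \<nu>" "sets \<nu> = sets \<mu>" "absolutely_continuous \<mu> \<nu>"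
    and p: "1 \<le> p" and fin: "Lp_norm p \<mu> (density_of \<nu> \<mu>) < \<infinity>"
    and h: "h \<in> borel_measurable \<mu>" "\<And>x. 0 \<le> h x" "\<And>x. h x \<le> 1"
    and b: "(\<integral>x. h x \<partial>\<mu>) \<le> 2 * exp (- x)"
  shows "(\<integral>z. h z \<partial>\<nu>) \<le> 2 * enn2real (Lp_norm p \<mu> (density_of \<nu> \<mu>)) *
      (if conjugate_exponent p = \<infinity> then 1 else exp (- (x / enn2real (conjugate_exponent p))))"
proof -
  interpret \<mu>: prob_space \<mu> by fact
  interpret \<nu>: prob_space \<nu> by fact
  define g where "g = density_of \<nu> \<mu>"
  have g[measurable]: "g \<in> borel_measurable \<mu>" and g0: "0 \<le> g z" for z
    unfolding g_def density_of_def[abs_def] by auto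
  note [measurable] = h(1)
  have change: "(\<integral>z. k z \<partial>\<nu>) = (\<integral>z. g z * k z \<partial>\<mu>)"
    and change_int: "integrable \<nu> k \<longleftrightarrow> integrable \<mu> (\<lambda>z. g z * k z)"
    if "k \<in> borel_measurable \<mu>" for k :: "'a \<Rightarrow> real"
    using \<mu>.RN_deriv_integral[OF \<nu>.sigma_finite_measure_axioms \<nu>(3,2) that]
      \<mu>.RN_deriv_integrable[OF \<nu>.sigma_finite_measure_axioms \<nu>(3,2) that]
    by (simp_all add: g_def density_of_def)
  have intg: "integrable \<mu> g" and g1: "(\<integral>z. g z \<partial>\<mu>) = 1"
    using change[of "\<lambda>_. 1"] change_int[of "\<lambda>_. 1"] by (simp_all add: \<nu>.prob_space)
  have inth: "integrable \<mu> h" using h by (intro \<mu>.integrable_const_bound[where B=1] AE_I2) auto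
  have intgh: "integrable \<mu> (\<lambda>z. g z * h z)"
    using h g0 by (intro Bochner_Integration.integrable_bound[OF intg]) (auto intro!: AE_I2 simp: mult_left_le)
  consider (inf) "p = \<infinity>" | (one) "p = 1" | (mid) "1 < p" "p < \<infinity>"
    using p by (auto simp: less_top[symmetric] less_le)
  then show ?thesis
  proof cases
    case inf
    define G where "G = enn2real (Lp_norm p \<mu> g)"
    have G: "esssup \<mu> (\<lambda>z. ennreal \<bar>g z\<bar>) = ennreal G"
      using fin inf by (simp add: G_def Lp_norm_def g_def less_top)
    have "AE z in \<mu>. ennreal \<bar>g z\<bar> \<le> ennreal G"
      unfolding G[symmetric] by (rule esssup_AE)
    then have "AE z in \<mu>. g z \<le> G"
      by eventually_elim (use g0 in \<open>auto simp: G_def ennreal_le_iff\<close>)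
    then have "AE z in \<mu>. g z * h z \<le> G * h z"
      by eventually_elim (use h in \<open>auto intro: mult_right_mono\<close>)
    then have "(\<integral>z. g z * h z \<partial>\<mu>) \<le> (\<integral>z. G * h z \<partial>\<mu>)"
      using intgh inth by (intro integral_mono_AE) auto
    also have "\<dots> \<le> G * (2 * exp (- x))"
      using b by (simp add: G_def mult_left_mono)
    finally show ?thesis
      using inf by (simp add: change h conjugate_exponent_def G_def g_def mult_ac)
  next
    case one
    have "(\<integral>\<^sup>+z. ennreal (\<bar>g z\<bar> powr enn2real p) \<partial>\<mu>) = 1"
      using g0 nn_integral_eq_integral[OF intg] by (simp add: one g1)
    then have "Lp_norm p \<mu> g = 1" using one by (simp add: Lp_norm_def)
    moreover have "(\<integral>z. h z \<partial>\<nu>) \<le> 1"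
      using abs_integral_le_prob[OF \<nu>(1), of h 1] h by simp
    ultimately show ?thesis using one by (simp add: conjugate_exponent_1 g_def)
  next
    case mid
    define r where "r = enn2real p"
    have p_r: "p = ennreal r" using mid by (simp add: r_def less_top)
    have "ennreal 1 < ennreal r" using mid(1) by (simp add: p_r)
    then have r: "1 < r" by (subst (asm) ennreal_less_iff) auto
    define r' where "r' = r / (r - 1)"
    have rr': "1 / r + 1 / r' = 1" using r by (simp add: r'_def field_simps)
    have q: "conjugate_exponent p = ennreal r'"
    proof -
      have "p - 1 = ennreal (r - 1)" using ennreal_minus[of 1 r] by (simp add: p_r)
      then have "p / (p - 1) = ennreal r / ennreal (r - 1)" by (simp add: p_r)
      also have "\<dots> = ennreal r'" unfolding r'_def using r by (intro divide_ennreal) auto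
      finally show ?thesis using mid by (simp add: conjugate_exponent_def)
    qed
    have r'0: "0 < r'" using r by (simp add: r'_def)
    have I: "(\<integral>\<^sup>+z. ennreal (\<bar>g z\<bar> powr r) \<partial>\<mu>) \<noteq> \<infinity>"
      using fin mid by (auto simp: Lp_norm_def g_def Let_def r_def split: if_splits)
    have intr: "integrable \<mu> (\<lambda>z. g z powr r)"
      using I g0 by (intro integrableI_bounded) (auto simp: less_top)
    have "(\<integral>\<^sup>+z. ennreal (\<bar>g z\<bar> powr r) \<partial>\<mu>) = ennreal (\<integral>z. g z powr r \<partial>\<mu>)"
      using nn_integral_eq_integral[OF intr] g0 by simp
    then have norm: "enn2real (Lp_norm p \<mu> g) = (\<integral>z. g z powr r \<partial>\<mu>) powr (1 / r)"
      using mid by (simp add: Lp_norm_def r_def)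
    have "(\<integral>z. g z * h z \<partial>\<mu>) \<le> enn2real (Lp_norm p \<mu> g) * (2 * exp (- x)) powr (1 / r')"
      unfolding norm using intr g0 h b by (intro Holder_powr_le[OF \<mu> r rr']) auto
    also have "(2 * exp (- x)) powr (1 / r') = 2 powr (1 / r') * exp (- (x / r'))"
      by (simp add: powr_mult exp_powr_real)
    \<comment> \<open>Hoelder's inequality yields the prefactor \<open>2 powr (1 / r')\<close>; it
      is rounded up to 2.\<close>
    also have "2 powr (1 / r') \<le> (2::real) powr 1"
    proof (rule powr_mono)
      show "1 / r' \<le> 1" using rr' r by (smt (verit) divide_nonneg_nonneg)
    qed simp
    finally have "(\<integral>z. g z * h z \<partial>\<mu>) \<le> enn2real (Lp_norm p \<mu> g) * (2 * exp (- (x / r')))"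
      by (simp add: mult_left_mono mult_right_mono)
    then show ?thesis
      using r'0 by (simp add: change h q g_def mult_ac)
  qed
qed

theorem theorem3p4:
  fixes W :: "'w measure"
    and P :: "'a::polish_space \<Rightarrow> 'w measure"
    and Z :: "real \<Rightarrow> 'w \<Rightarrow> 'a"
    and \<mu> \<nu> :: "'a measure"
    and f :: "'a \<Rightarrow> real"
    and p q :: ennreal
    and \<eta> M \<sigma> t \<delta> :: real
  assumes "markov_process W P Z"
    and "invariant_distribution P Z \<mu>"
    and "iterated_poincare_gap P Z \<mu> \<eta>"
    and "prob_space \<nu>" and "sets \<nu> = sets borel"
    and "absolutely_continuous \<mu> \<nu>"
    and "1 \<le> p"
    and "Lp_norm p \<mu> (density_of \<nu> \<mu>) < \<infinity>"
    and "q = conjugate_exponent p"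
    and "f \<in> borel_measurable borel"
    and "0 < M" and "0 < \<sigma>"
    and "(\<integral>z. f z \<partial>\<mu>) = 0"
    and "\<And>z. \<bar>f z\<bar> \<le> M"
    and "prob_space.variance \<mu> f \<le> \<sigma>\<^sup>2"
    and "weakly_right_continuous W P Z f"
    and "(\<lambda>(s, \<omega>). f (Z s \<omega>)) \<in> borel_measurable (restrict_space borel {0..} \<Otimes>\<^sub>M W)"
    and "0 < t" and "0 \<le> \<delta>"
  shows "measure (\<nu> \<bind> P) {\<omega> \<in> space W. \<delta> \<le> \<bar>1 / t * (LINT s:{0..t}|lborel. f (Z s \<omega>))\<bar>}
    \<le> 2 * enn2real (Lp_norm p \<mu> (density_of \<nu> \<mu>)) *
       (if q = \<infinity> then 1
        else exp (- (t * \<eta> * \<delta>\<^sup>2 / (4 * enn2real q * M * sqrt (4 * \<sigma>\<^sup>2 + \<delta>\<^sup>2)))))"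
proof -
  interpret markov_process W P Z by fact
  interpret stationary_functional W P Z f M \<mu> \<eta> \<sigma>
    by unfold_locales (use assms in auto)
  interpret \<nu>: prob_space \<nu> by fact
  define A where "A = {\<omega> \<in> space W. \<delta> \<le> \<bar>1 / t * additive 0 t \<omega>\<bar>}"
  \<comment> \<open>The exponent under the stationary law. The change of measure divides it by
    \<open>q\<close>, which is how \<open>q\<close> enters the denominator.\<close>
  define x where "x = t * \<eta> * \<delta>\<^sup>2 / (4 * M * sqrt (4 * \<sigma>\<^sup>2 + \<delta>\<^sup>2))"
  have add_meas[measurable]: "additive 0 t \<in> borel_measurable W" by simp
  have A: "A \<in> sets W" unfolding A_def by measurable
  have kernel_\<nu>: "P \<in> \<nu> \<rightarrow>\<^sub>M subprob_algebra W"
    using measurable_prob_algebraD[OF kernel] by (simp add: measurable_cong_sets[OF \<open>sets \<nu> = sets borel\<close> refl])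
  have [measurable]: "(\<lambda>z. measure (P z) A) \<in> borel_measurable borel"
    using measurable_compose[OF measurable_prob_algebraD[OF kernel] measurable_measure_subprob_algebra[OF A]] .
  have "(\<integral>z. measure (P z) A \<partial>\<mu>) = measure stationary A"
    using \<mu>.measure_bind[OF measurable_prob_algebraD[OF kernel_\<mu>] A] by simp
  also have "\<dots> \<le> 2 * exp (- x)"
    unfolding A_def x_def by (rule stationary_tail) fact+
  \<comment> \<open>The function passed to \<open>integral_le_Lp_norm_density\<close> is the
    probability of \<open>A\<close> as a function of the starting point: its mean under
    \<open>\<mu>\<close> is the stationary probability of \<open>A\<close>, its mean under
    \<open>\<nu>\<close> the probability to be bounded.\<close>
  finally have "(\<integral>z. measure (P z) A \<partial>\<nu>) \<le> 2 * enn2real (Lp_norm p \<mu> (density_of \<nu> \<mu>)) *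
      (if conjugate_exponent p = \<infinity> then 1 else exp (- (x / enn2real (conjugate_exponent p))))"
    using assms prob_space.prob_le_1[OF prob_space_P]
    by (intro integral_le_Lp_norm_density \<mu>.prob_space_axioms) (auto simp: sets_\<mu>)
  also have "(\<integral>z. measure (P z) A \<partial>\<nu>) = measure (\<nu> \<bind> P) A"
    using \<nu>.measure_bind[OF kernel_\<nu> A] by simp
  also have "x / enn2real (conjugate_exponent p)
      = t * \<eta> * \<delta>\<^sup>2 / (4 * enn2real q * M * sqrt (4 * \<sigma>\<^sup>2 + \<delta>\<^sup>2))"
    by (simp add: x_def \<open>q = conjugate_exponent p\<close> mult_ac)
  finally show ?thesis
    by (simp add: A_def additive_def \<open>q = conjugate_exponent p\<close>)
qed

end
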